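(* Let $\Omega\subset\mathbb C$ be a domain and $h\in\mathscr W^{1,2}(\Omega)$ complex valued. For $\eta\in\mathscr C_0^\infty(\Omega)$ and real $\varepsilon$ close to $0$ define $H_\varepsilon:\Omega\to\mathbb C$ by $H_\varepsilon(z)=h(\xi)$, where $z=\xi+\varepsilon\eta(\xi)$, $\xi\in\Omega$. Then $$\frac{d}{d\varepsilon}\,\mathscr E[H_\varepsilon]\Big|_{\varepsilon=0}=0\quad\text{for all }\eta\in\mathscr C_0^\infty(\Omega)$$ if and only if $h$ satisfies the Hopf-Laplace equation $$\frac{\partial}{\partial\bar\xi}\left(h_\xi\,\overline{h_{\bar\xi}}\right)=0\quad\text{in the sense of distributions on }\Omega.$$
   Context: Subscripts $\xi,\bar\xi$ denote the complex derivatives $\frac12(\partial_x-i\partial_y)$, $\frac12(\partial_x+i\partial_y)$; $\mathscr E[h]=\int_\Omega(|h_\xi|^2+|h_{\bar\xi}|^2)\,\mathbf{d}\xi$ is the Dirichlet energy, $\mathbf{d}\xi$ being the area element. $\mathscr C_0^\infty(\Omega)$ consists of complex-valued smooth functions with compact support in $\Omega$. For $\varepsilon$ sufficiently small (depending on $\eta$) the map $\xi\mapsto\xi+\varepsilon\eta(\xi)$ is a $\mathscr C^\infty$-diffeomorphism of $\Omega$ onto itself. *)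

theory Defs
  imports "HOL-Analysis.Analysis"
begin

section \<open>Test functions\<close>

definition dir_deriv :: "complex \<Rightarrow> (complex \<Rightarrow> complex) \<Rightarrow> complex \<Rightarrow> complex" where
  "dir_deriv v f = (\<lambda>z. frechet_derivative f (at z) v)"

text \<open>Differentiability is real (Frechet) differentiability on the real vector space of complex
  numbers: \<open>f\<close> is smooth when every iterated directional derivative of \<open>f\<close> is everywhere
  differentiable.\<close>

definition smooth :: "(complex \<Rightarrow> complex) \<Rightarrow> bool" where
  "smooth f \<longleftrightarrow> (\<forall>vs. foldr dir_deriv vs f differentiable_on UNIV)"

text \<open>An element of \<open>C\<^sub>0\<^sup>\<infinity>(\<Omega>)\<close> is represented by its extension by zero to the whole plane.\<close>

definition test_functions :: "complex set \<Rightarrow> (complex \<Rightarrow> complex) set" where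
  "test_functions \<Omega> =
     {\<phi>. smooth \<phi> \<and> compact (closure {z. \<phi> z \<noteq> 0}) \<and> closure {z. \<phi> z \<noteq> 0} \<subseteq> \<Omega>}"


section \<open>Distributions and weak derivatives\<close>

text \<open>Distributions on \<open>\<Omega>\<close> occur only through their values on \<open>test_functions \<Omega>\<close>. The pairing is
  complex bilinear (no conjugation).\<close>

type_synonym distribution = "(complex \<Rightarrow> complex) \<Rightarrow> complex"

definition distr_of :: "complex set \<Rightarrow> (complex \<Rightarrow> complex) \<Rightarrow> distribution" where
  "distr_of \<Omega> f = (\<lambda>\<phi>. LINT z|lebesgue_on \<Omega>. f z * \<phi> z)"

definition distr_deriv :: "complex \<Rightarrow> distribution \<Rightarrow> distribution" where
  "distr_deriv v T = (\<lambda>\<phi>. - T (dir_deriv v \<phi>))"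

definition distr_dbar :: "distribution \<Rightarrow> distribution" where
  "distr_dbar T = (\<lambda>\<phi>. (distr_deriv 1 T \<phi> + \<i> * distr_deriv \<i> T \<phi>) / 2)"

definition locally_integrable :: "complex set \<Rightarrow> (complex \<Rightarrow> complex) \<Rightarrow> bool" where
  "locally_integrable \<Omega> f \<longleftrightarrow>
     (\<forall>K. compact K \<and> K \<subseteq> \<Omega> \<longrightarrow> integrable (lebesgue_on K) f)"

definition has_weak_deriv ::
  "complex set \<Rightarrow> complex \<Rightarrow> (complex \<Rightarrow> complex) \<Rightarrow> (complex \<Rightarrow> complex) \<Rightarrow> bool" where
  "has_weak_deriv \<Omega> v f g \<longleftrightarrow>
     locally_integrable \<Omega> f \<and> locally_integrable \<Omega> g \<and>
     (\<forall>\<phi>\<in>test_functions \<Omega>. distr_deriv v (distr_of \<Omega> f) \<phi> = distr_of \<Omega> g \<phi>)"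

text \<open>A weak derivative is determined only up to a null set; \<open>weak_deriv\<close> selects a representative,
  and is meaningful only when a weak derivative exists.\<close>

definition weak_deriv ::
  "complex set \<Rightarrow> complex \<Rightarrow> (complex \<Rightarrow> complex) \<Rightarrow> complex \<Rightarrow> complex" where
  "weak_deriv \<Omega> v f = (SOME g. has_weak_deriv \<Omega> v f g)"

definition weak_dz :: "complex set \<Rightarrow> (complex \<Rightarrow> complex) \<Rightarrow> complex \<Rightarrow> complex" where
  "weak_dz \<Omega> f = (\<lambda>z. (weak_deriv \<Omega> 1 f z - \<i> * weak_deriv \<Omega> \<i> f z) / 2)"

definition weak_dbar :: "complex set \<Rightarrow> (complex \<Rightarrow> complex) \<Rightarrow> complex \<Rightarrow> complex" where
  "weak_dbar \<Omega> f = (\<lambda>z. (weak_deriv \<Omega> 1 f z + \<i> * weak_deriv \<Omega> \<i> f z) / 2)"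


section \<open>The Sobolev space and the Dirichlet energy\<close>

definition L2 :: "complex set \<Rightarrow> (complex \<Rightarrow> complex) set" where
  "L2 \<Omega> = {f. f \<in> borel_measurable (lebesgue_on \<Omega>) \<and>
              integrable (lebesgue_on \<Omega>) (\<lambda>z. (cmod (f z))\<^sup>2)}"

definition W12 :: "complex set \<Rightarrow> (complex \<Rightarrow> complex) set" where
  "W12 \<Omega> = {f \<in> L2 \<Omega>. \<forall>v\<in>{1, \<i>}. \<exists>g\<in>L2 \<Omega>. has_weak_deriv \<Omega> v f g}"

text \<open>As a Bochner integral, this is the Dirichlet energy for functions in \<open>W12 \<Omega>\<close>.\<close>

definition dirichlet_energy :: "complex set \<Rightarrow> (complex \<Rightarrow> complex) \<Rightarrow> real" where
  "dirichlet_energy \<Omega> f =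
     (LINT z|lebesgue_on \<Omega>. (cmod (weak_dz \<Omega> f z))\<^sup>2 + (cmod (weak_dbar \<Omega> f z))\<^sup>2)"

text \<open>The function \<open>H\<^sub>\<epsilon>\<close> with \<open>H\<^sub>\<epsilon> (\<xi> + \<epsilon> \<eta> \<xi>) = h \<xi>\<close> for \<open>\<xi> \<in> \<Omega>\<close>. It is meaningful when
  \<open>\<xi> \<mapsto> \<xi> + \<epsilon> \<eta> \<xi>\<close> is a bijection of \<open>\<Omega>\<close> onto itself, hence for all \<open>\<epsilon>\<close> near \<open>0\<close> when \<open>\<eta>\<close> is a
  test function; its values off \<open>\<Omega>\<close> are irrelevant.\<close>

definition inner_variation ::
  "complex set \<Rightarrow> (complex \<Rightarrow> complex) \<Rightarrow> (complex \<Rightarrow> complex) \<Rightarrow> real \<Rightarrow> complex \<Rightarrow> complex" where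
  "inner_variation \<Omega> \<eta> h \<epsilon> =
     (\<lambda>z. h (the_inv_into \<Omega> (\<lambda>\<xi>. \<xi> + complex_of_real \<epsilon> * \<eta> \<xi>) z))"

end

theory Submission
  imports Defs "HOL-Computational_Algebra.Polynomial"
begin

text \<open>Write \<open>\<Phi> = id + \<epsilon> \<eta>\<close> and \<open>H = h \<circ> \<Phi>\<^sup>-\<^sup>1\<close>. Testing \<open>H\<close> against \<open>\<phi>\<close> and substituting
  \<open>z = \<Phi> \<xi>\<close> turns \<open>(\<partial>\<phi> \<circ> \<Phi>) det D\<Phi>\<close> into a divergence of the test functions \<open>cof(D\<Phi>) (\<phi> \<circ> \<Phi>)\<close>
  (Piola), so the chain rule for the weak derivatives of \<open>H\<close> follows from their definition, without
  approximating \<open>h\<close> by smooth functions and without any regularity of \<open>\<Phi>\<^sup>-\<^sup>1\<close>. A second substitution writes the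
  energy of \<open>H\<close> as an integral over \<open>\<Omega>\<close> of a quadratic form in the weak derivatives of \<open>h\<close> whose
  coefficients are rational in \<open>\<epsilon>\<close>; a first order expansion with an error \<open>O(\<epsilon>\<^sup>2)\<close> relative to \<open>\<bar>Dh\<bar>\<^sup>2\<close> gives the
  derivative at \<open>0\<close> as four times the real part of the distribution \<open>\<partial>(h\<^sub>\<xi> cnj(h\<^bsub>\<xi>bar\<^esub>)) / \<partial>\<xi>bar\<close>
  at \<open>\<eta>\<close>. Replacing \<open>\<eta>\<close> by \<open>\<i> \<eta>\<close> recovers the imaginary part.\<close>

section \<open>Calculus of smooth functions\<close>

lemma dir_deriv_eq:
  assumes "(f has_derivative f') (at z)"
  shows "dir_deriv v f z = f' v"
  using assms frechet_derivative_at unfolding dir_deriv_def by metis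

lemma smooth_differentiable: "smooth f \<Longrightarrow> f differentiable (at z)"
  unfolding smooth_def differentiable_on_def
  by (metis UNIV_I foldr.simps(1) id_apply)

lemma smooth_has_derivative:
  assumes "smooth f"
  shows "(f has_derivative (\<lambda>v. dir_deriv v f z)) (at z)"
  using smooth_differentiable[OF assms] frechet_derivative_works
  unfolding dir_deriv_def by blast

lemma smooth_dir_deriv: "smooth f \<Longrightarrow> smooth (dir_deriv v f)"
  unfolding smooth_def
proof
  fix vs assume "\<forall>vs. foldr dir_deriv vs f differentiable_on UNIV"
  \<comment> \<open>\<open>foldr\<close> applies the last list entry first, so the iterates of
    \<open>dir_deriv v f\<close> are those iterates of \<open>f\<close> whose list ends in
    \<open>v\<close>.\<close>
  then have "foldr dir_deriv (vs @ [v]) f differentiable_on UNIV" by blast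
  then show "foldr dir_deriv vs (dir_deriv v f) differentiable_on UNIV" by simp
qed

text \<open>Smoothness quantifies over all iterated derivatives, so it suffices to exhibit a class
  of differentiable functions containing \<open>f\<close> that is stable under every
  \<open>dir_deriv v\<close>. All smoothness proofs for concrete functions choose such a
  class.\<close>

lemma smooth_coinduct:
  assumes "P f"
    and diff: "\<And>f z. P f \<Longrightarrow> f differentiable (at z)"
    and step: "\<And>f v. P f \<Longrightarrow> P (dir_deriv v f)"
  shows "smooth f"
proof -
  have "P (foldr dir_deriv vs f)" for vs
    by (induction vs) (use assms in auto)
  then show ?thesis
    unfolding smooth_def differentiable_on_def using diff differentiable_at_withinI by blast
qed

lemma smooth_continuous: "smooth f \<Longrightarrow> continuous_on S f"
  by (meson continuous_at_imp_continuous_on differentiable_imp_continuous_within smooth_differentiable)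

text \<open>In the chain rule the direction of the outer derivative varies with the point. Splitting
  it into the fixed directions 1 and \<i> leaves derivatives of the outer function that are again
  smooth functions.\<close>

lemma dir_deriv_linear:
  assumes "smooth f"
  shows "dir_deriv v f z = Re v * dir_deriv 1 f z + Im v * dir_deriv \<i> f z"
proof -
  interpret bounded_linear "\<lambda>v. dir_deriv v f z"
    using has_derivative_bounded_linear[OF smooth_has_derivative[OF assms]] .
  have "dir_deriv v f z = dir_deriv (Re v *\<^sub>R 1 + Im v *\<^sub>R \<i>) f z"
    by (rule arg_cong[where f="\<lambda>v. dir_deriv v f z"]) (simp add: complex_eq_iff)
  then show ?thesis by (simp only: add scaleR) (simp add: scaleR_conv_of_real)
qed

text \<open>The derivative of a product is a sum of products, and that of a composition contains
  both products and compositions, so no single operation gives a class stable under differentiation.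
  Closing under all of them at once does. In \<open>comp\<close> the outer function is taken smooth,
  because its derivatives are then smooth as well.\<close>

inductive smooth_closure :: "(complex \<Rightarrow> complex) \<Rightarrow> bool" where
  base: "smooth f \<Longrightarrow> smooth_closure f"
| add: "smooth_closure f \<Longrightarrow> smooth_closure g \<Longrightarrow> smooth_closure (\<lambda>z. f z + g z)"
| mult: "smooth_closure f \<Longrightarrow> smooth_closure g \<Longrightarrow> smooth_closure (\<lambda>z. f z * g z)"
| linear: "smooth_closure f \<Longrightarrow> bounded_linear L \<Longrightarrow> smooth_closure (\<lambda>z. L (f z))"
| comp: "smooth f \<Longrightarrow> smooth_closure g \<Longrightarrow> smooth_closure (\<lambda>z. f (g z))"

lemma bounded_linear_of_real_Re: "bounded_linear (\<lambda>z. complex_of_real (Re z))"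
  by (rule bounded_linear_compose[OF bounded_linear_of_real bounded_linear_Re])

lemma bounded_linear_of_real_Im: "bounded_linear (\<lambda>z. complex_of_real (Im z))"
  by (rule bounded_linear_compose[OF bounded_linear_of_real bounded_linear_Im])

text \<open>Sum, product and chain rules express each directional derivative through members of the
  class and their derivatives; these are the two premises of \<open>smooth_coinduct\<close>.\<close>

lemma smooth_closure_step:
  assumes "smooth_closure f"
  shows "(\<forall>z. f differentiable (at z)) \<and> (\<forall>v. smooth_closure (dir_deriv v f))"
  using assms
proof induction
  case (base f)
  then show ?case
    by (auto intro: smooth_closure.intros smooth_dir_deriv smooth_differentiable)
next
  case (add f g)
  have "dir_deriv v (\<lambda>z. f z + g z) = (\<lambda>z. dir_deriv v f z + dir_deriv v g z)" for v
  proof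
    fix z
    have "((\<lambda>z. f z + g z) has_derivative (\<lambda>v. dir_deriv v f z + dir_deriv v g z)) (at z)"
      unfolding dir_deriv_def using add.IH
      by (auto intro!: has_derivative_add simp flip: frechet_derivative_works)
    then show "dir_deriv v (\<lambda>z. f z + g z) z = dir_deriv v f z + dir_deriv v g z"
      by (rule dir_deriv_eq)
  qed
  with add show ?case by (auto intro: smooth_closure.intros)
next
  case (mult f g)
  have "dir_deriv v (\<lambda>z. f z * g z) = (\<lambda>z. f z * dir_deriv v g z + dir_deriv v f z * g z)" for v
  proof
    fix z
    have "((\<lambda>z. f z * g z) has_derivative (\<lambda>v. f z * dir_deriv v g z + dir_deriv v f z * g z)) (at z)"
      unfolding dir_deriv_def using mult.IH
      by (auto intro!: has_derivative_mult simp flip: frechet_derivative_works)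
    then show "dir_deriv v (\<lambda>z. f z * g z) z = f z * dir_deriv v g z + dir_deriv v f z * g z"
      by (rule dir_deriv_eq)
  qed
  with mult show ?case by (auto intro!: smooth_closure.add smooth_closure.mult)
next
  case (linear f L)
  have d: "((\<lambda>z. L (f z)) has_derivative (\<lambda>v. L (dir_deriv v f z))) (at z)" for z
  proof (rule bounded_linear.has_derivative[OF linear(2)])
    show "(f has_derivative (\<lambda>v. dir_deriv v f z)) (at z)"
      unfolding dir_deriv_def using linear.IH frechet_derivative_works by blast
  qed
  have "dir_deriv v (\<lambda>z. L (f z)) = (\<lambda>z. L (dir_deriv v f z))" for v
    using dir_deriv_eq[OF d] by blast
  moreover have "\<forall>z. (\<lambda>z. L (f z)) differentiable (at z)"
    using d differentiable_def by blast
  ultimately show ?case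
    using smooth_closure.linear[OF _ linear(2)] linear.IH by presburger
next
  case (comp f g)
  have d: "((\<lambda>z. f (g z)) has_derivative (\<lambda>v. dir_deriv (dir_deriv v g z) f (g z))) (at z)" for z
    by (rule has_derivative_compose[OF _ smooth_has_derivative[OF comp(1)]])
       (unfold dir_deriv_def, use comp.IH frechet_derivative_works in blast)
  then have diff: "\<forall>z. (\<lambda>z. f (g z)) differentiable (at z)"
    using differentiable_def by blast
  have "dir_deriv v (\<lambda>z. f (g z)) = (\<lambda>z. Re (dir_deriv v g z) * dir_deriv 1 f (g z) +
           Im (dir_deriv v g z) * dir_deriv \<i> f (g z))" for v
    unfolding dir_deriv_linear[OF comp(1), symmetric] using dir_deriv_eq[OF d] by blast
  moreover have "smooth_closure (\<lambda>z. Re (dir_deriv v g z) * dir_deriv 1 f (g z) +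
      Im (dir_deriv v g z) * dir_deriv \<i> f (g z))" for v
  proof -
    have g: "smooth_closure (dir_deriv v g)" using comp.IH by blast
    show ?thesis
      by (rule smooth_closure.add[OF
          smooth_closure.mult[OF smooth_closure.linear[OF g bounded_linear_of_real_Re]
            smooth_closure.comp[OF smooth_dir_deriv[OF comp(1)] comp(2)]]
          smooth_closure.mult[OF smooth_closure.linear[OF g bounded_linear_of_real_Im]
            smooth_closure.comp[OF smooth_dir_deriv[OF comp(1)] comp(2)]]])
  qed
  ultimately show ?case using diff by presburger
qed

lemma smooth_closure_imp_smooth: "smooth_closure f \<Longrightarrow> smooth f"
  by (rule smooth_coinduct[where P = smooth_closure]) (use smooth_closure_step in auto)

lemma smooth_add: "smooth f \<Longrightarrow> smooth g \<Longrightarrow> smooth (\<lambda>z. f z + g z)"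
  and smooth_mult: "smooth f \<Longrightarrow> smooth g \<Longrightarrow> smooth (\<lambda>z. f z * g z)"
  and smooth_linear: "bounded_linear L \<Longrightarrow> smooth f \<Longrightarrow> smooth (\<lambda>z. L (f z))"
  and smooth_compose: "smooth f \<Longrightarrow> smooth g \<Longrightarrow> smooth (\<lambda>z. f (g z))"
  by (auto intro!: smooth_closure_imp_smooth intro: smooth_closure.intros)

section \<open>Elementary smooth functions and a flat function on the line\<close>

lemma smooth_const: "smooth (\<lambda>z. c)"
  by (rule smooth_coinduct[where P = "\<lambda>f. \<exists>c. f = (\<lambda>z. c)"]) (auto simp: dir_deriv_def)

lemma smooth_ident: "smooth (\<lambda>z. z)"
proof (rule smooth_coinduct[where P = "\<lambda>f. f = (\<lambda>z. z) \<or> (\<exists>c. f = (\<lambda>z. c))"])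
  fix f :: "complex \<Rightarrow> complex" and v
  have "dir_deriv v (\<lambda>z. z) = (\<lambda>z. v)" "\<And>c. dir_deriv v (\<lambda>z. c) = (\<lambda>z. 0)"
    by (auto simp: dir_deriv_def)
  then show "f = (\<lambda>z. z) \<or> (\<exists>c. f = (\<lambda>z. c)) \<Longrightarrow>
    dir_deriv v f = (\<lambda>z. z) \<or> (\<exists>c. dir_deriv v f = (\<lambda>z. c))" by auto
qed auto

lemma smooth_Re: "smooth f \<Longrightarrow> smooth (\<lambda>z. complex_of_real (Re (f z)))"
  and smooth_Im: "smooth f \<Longrightarrow> smooth (\<lambda>z. complex_of_real (Im (f z)))"
  by (rule smooth_linear[OF bounded_linear_of_real_Re] smooth_linear[OF bounded_linear_of_real_Im], assumption)+

lemma smooth_minus: "smooth f \<Longrightarrow> smooth (\<lambda>z. - f z)"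
  using smooth_mult[OF smooth_const[of "-1"]] by simp

lemma smooth_diff: "smooth f \<Longrightarrow> smooth g \<Longrightarrow> smooth (\<lambda>z. f z - g z)"
  using smooth_add[of f "\<lambda>z. - g z"] smooth_minus by simp

lemma smooth_exp: "smooth (exp :: complex \<Rightarrow> complex)"
proof (rule smooth_coinduct[where P = "\<lambda>f. \<exists>c. f = (\<lambda>z. c * exp z)"])
  have d: "((\<lambda>z. c * exp z) has_derivative (\<lambda>v. (c * exp z) * v)) (at z)" for c z :: complex
    by (auto intro!: derivative_eq_intros)
  show "\<exists>c. (exp :: complex \<Rightarrow> complex) = (\<lambda>z. c * exp z)" by (auto intro: exI[of _ 1])
  show "f differentiable (at z)" if "\<exists>c. f = (\<lambda>z. c * exp z)" for f :: "complex \<Rightarrow> complex" and z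
    using that d by (auto simp: differentiable_def)
  show "\<exists>c. dir_deriv v f = (\<lambda>z. c * exp z)" if "\<exists>c. f = (\<lambda>z. c * exp z)" for f v
  proof -
    from that obtain c where "f = (\<lambda>z. c * exp z)" by blast
    with dir_deriv_eq[OF d] have "dir_deriv v f = (\<lambda>z. (c * v) * exp z)" by (auto simp: mult_ac)
    then show ?thesis by blast
  qed
qed

text \<open>The family \<open>flat p\<close> is closed under differentiation, which makes \<open>flat 1\<close> smooth.\<close>

definition flat :: "real poly \<Rightarrow> real \<Rightarrow> real" where
  "flat p x = (if x > 0 then poly p (inverse x) * exp (- inverse x) else 0)"

lemma poly_times_exp_minus_tendsto_0:
  "((\<lambda>y. poly p y * exp (- y)) \<longlongrightarrow> 0) (at_top :: real filter)"
proof -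
  have "((\<lambda>y. \<Sum>i\<le>degree p. coeff p i * (y ^ i / exp y)) \<longlongrightarrow> (\<Sum>i\<le>degree p. coeff p i * 0)) at_top"
    by (intro tendsto_intros tendsto_power_div_exp_0)
  then show ?thesis
    by (simp add: poly_altdef sum_distrib_right exp_minus divide_inverse mult.assoc)
qed

text \<open>For positive \<open>x\<close>, differentiating \<open>p(1/x) exp(-1/x)\<close> gives
  \<open>(p - p')(1/x) x^(-2) exp(-1/x)\<close>, and \<open>x^(-2)\<close> is the monomial of degree
  2 in \<open>1/x\<close>. At 0 the right difference quotient is the same kind of expression with
  \<open>pCons 0 p\<close> in place of \<open>p\<close>, and the exponential beats the
  polynomial.\<close>

lemma flat_has_derivative:
  "(flat p has_real_derivative flat ((p - pderiv p) * monom 1 2) x) (at x)"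
proof -
  consider "x > 0" | "x < 0" | "x = 0" by linarith
  then show ?thesis
  proof cases
    case 1
    have "((\<lambda>x. poly p (inverse x) * exp (- inverse x)) has_real_derivative
        flat ((p - pderiv p) * monom 1 2) x) (at x)"
      using 1 by (auto intro!: derivative_eq_intros DERIV_chain2[OF poly_DERIV]
          simp: flat_def poly_monom field_simps power2_eq_square)
    then show ?thesis
      by (rule has_field_derivative_transform_within_open[of _ _ _ "{0<..}"]) (use 1 in \<open>auto simp: flat_def\<close>)
  next
    case 2
    have "((\<lambda>x. 0) has_real_derivative flat ((p - pderiv p) * monom 1 2) x) (at x)"
      using 2 by (auto simp: flat_def)
    then show ?thesis
      by (rule has_field_derivative_transform_within_open[of _ _ _ "{..<0}"]) (use 2 in \<open>auto simp: flat_def\<close>)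
  next
    case 3
    have "((\<lambda>y. flat p y / y) \<longlongrightarrow> 0) (at_left 0)"
      by (rule tendsto_eventually) (auto simp: flat_def eventually_at_filter)
    moreover have "((\<lambda>y. flat p y / y) \<longlongrightarrow> 0) (at_right 0)"
    proof -
      have "((\<lambda>y. poly (pCons 0 p) (inverse y) * exp (- inverse y)) \<longlongrightarrow> 0) (at_right (0::real))"
        by (rule filterlim_compose[OF poly_times_exp_minus_tendsto_0 filterlim_inverse_at_top_right])
      then show ?thesis
        by (rule Lim_transform_eventually) (auto simp: flat_def eventually_at_filter field_simps)
    qed
    ultimately have "((\<lambda>y. flat p y / y) \<longlongrightarrow> 0) (at 0)"
      by (simp add: filterlim_split_at)
    then show ?thesis using 3 by (simp add: has_field_derivative_iff flat_def)
  qed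
qed

lemma smooth_flat: "smooth (\<lambda>z. complex_of_real (flat p (Re z)))"
proof (rule smooth_coinduct[where P = "\<lambda>f. \<exists>p. f = (\<lambda>z. complex_of_real (flat p (Re z)))"])
  have d: "((\<lambda>z. complex_of_real (flat p (Re z))) has_derivative
      (\<lambda>v. complex_of_real (flat ((p - pderiv p) * monom 1 2) (Re z) * Re v))) (at z)" for p z
    by (intro has_derivative_of_real has_derivative_compose[OF has_derivative_Re[OF has_derivative_ident]
          flat_has_derivative[THEN has_field_derivative_imp_has_derivative]])
  show "f differentiable (at z)" if "\<exists>p. f = (\<lambda>z. complex_of_real (flat p (Re z)))" for f and z
    using that d by (auto simp: differentiable_def)
  show "\<exists>p. dir_deriv v f = (\<lambda>z. complex_of_real (flat p (Re z)))"
    if "\<exists>p. f = (\<lambda>z. complex_of_real (flat p (Re z)))" for f v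
  proof -
    from that obtain p where "f = (\<lambda>z. complex_of_real (flat p (Re z)))" by blast
    \<comment> \<open>The chain rule contributes the constant factor \<open>Re v\<close>, which is
      absorbed into the polynomial by \<open>smult\<close>.\<close>
    with dir_deriv_eq[OF d] have "dir_deriv v f =
        (\<lambda>z. complex_of_real (flat (smult (Re v) ((p - pderiv p) * monom 1 2)) (Re z)))"
      by (auto simp: flat_def)
    then show ?thesis by blast
  qed
qed blast

section \<open>Symmetry of mixed second derivatives\<close>

lemma smooth_has_real_derivative_line:
  assumes "smooth f" "bounded_linear (L :: complex \<Rightarrow> real)"
  shows "((\<lambda>t. L (f (z + of_real t * v))) has_real_derivative L (dir_deriv v f (z + of_real s * v))) (at s)"
proof -
  have "((\<lambda>t. f (z + of_real t * v)) has_derivative (\<lambda>h. dir_deriv (of_real h * v) f (z + of_real s * v))) (at s)"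
    by (rule has_derivative_compose[OF _ smooth_has_derivative[OF assms(1)]])
       (auto intro!: derivative_eq_intros)
  then have "((\<lambda>t. L (f (z + of_real t * v))) has_derivative (\<lambda>h. L (dir_deriv (of_real h * v) f (z + of_real s * v)))) (at s)"
    using bounded_linear.has_derivative[OF assms(2)] by blast
  moreover have "L (dir_deriv (of_real h * v) f w) = h * L (dir_deriv v f w)" for h w
  proof -
    have "dir_deriv (of_real h * v) f w = h *\<^sub>R dir_deriv v f w"
      using linear_scale[OF has_derivative_linear[OF smooth_has_derivative[OF assms(1)]]]
      by (metis scaleR_conv_of_real)
    then show ?thesis using linear_scale[OF bounded_linear.linear[OF assms(2)]] by simp
  qed
  then have "(\<lambda>h. L (dir_deriv (of_real h * v) f (z + of_real s * v))) = (*) (L (dir_deriv v f (z + of_real s * v)))"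
    by (auto simp: mult.commute)
  ultimately show ?thesis by (simp only: has_field_derivative_def)
qed

text \<open>Two applications of the mean value theorem, first along \<open>u\<close> to the
  difference in direction \<open>v\<close>, then along \<open>v\<close>. The real functional
  \<open>L\<close> is there because the mean value theorem fails for complex values. The left-hand
  side is symmetric in \<open>u\<close> and \<open>v\<close>, while the right-hand side records an
  order of differentiation.\<close>

lemma second_difference_mvt:
  fixes s :: real
  assumes "smooth f" "bounded_linear (L :: complex \<Rightarrow> real)" "s > 0"
  obtains a b :: real where "0 < a" "a < s" "0 < b" "b < s"
    "L (f (z + of_real s * u + of_real s * v)) - L (f (z + of_real s * u)) - L (f (z + of_real s * v)) + L (f z)
       = s\<^sup>2 * L (dir_deriv v (dir_deriv u f) (z + of_real a * u + of_real b * v))"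
proof -
  define G where "G a = L (f ((z + of_real s * v) + of_real a * u)) - L (f (z + of_real a * u))" for a
  have "\<exists>a. 0 < a \<and> a < s \<and> G s - G 0 =
      (s - 0) * (L (dir_deriv u f ((z + of_real s * v) + of_real a * u)) - L (dir_deriv u f (z + of_real a * u)))"
    unfolding G_def
    by (rule MVT2[OF \<open>s > 0\<close>])
       (intro DERIV_diff smooth_has_real_derivative_line assms)
  then obtain a where a: "0 < a" "a < s" "G s - G 0 =
      s * (L (dir_deriv u f ((z + of_real s * v) + of_real a * u)) - L (dir_deriv u f (z + of_real a * u)))"
    by auto
  have "\<exists>b. 0 < b \<and> b < s \<and> L (dir_deriv u f ((z + of_real a * u) + of_real s * v)) - L (dir_deriv u f ((z + of_real a * u) + of_real 0 * v)) =
      (s - 0) * L (dir_deriv v (dir_deriv u f) ((z + of_real a * u) + of_real b * v))"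
    by (rule MVT2[OF \<open>s > 0\<close>])
       (intro smooth_has_real_derivative_line smooth_dir_deriv assms)
  then obtain b where b: "0 < b" "b < s" "L (dir_deriv u f ((z + of_real a * u) + of_real s * v)) - L (dir_deriv u f (z + of_real a * u)) =
      s * L (dir_deriv v (dir_deriv u f) ((z + of_real a * u) + of_real b * v))" by auto
  have "L (f (z + of_real s * u + of_real s * v)) - L (f (z + of_real s * u)) - L (f (z + of_real s * v)) + L (f z) = G s - G 0"
    by (simp add: G_def algebra_simps)
  also have "\<dots> = s * (s * L (dir_deriv v (dir_deriv u f) ((z + of_real a * u) + of_real b * v)))"
    using a b by (simp add: algebra_simps)
  finally show thesis using a b by (intro that[of a b]) (auto simp: power2_eq_square algebra_simps)
qed

text \<open>Applying \<open>second_difference_mvt\<close> in both orders to the same second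
  difference equates the two mixed derivatives at nearby intermediate points. As the step
  \<open>X n\<close> shrinks, these points converge to \<open>z\<close>, and continuity of the
  second derivatives gives the equality at \<open>z\<close>.\<close>

lemma dir_deriv_commute_linear:
  assumes "smooth f" "bounded_linear (L :: complex \<Rightarrow> real)"
  shows "L (dir_deriv u (dir_deriv v f) z) = L (dir_deriv v (dir_deriv u f) z)"
proof -
  define X where "X n = inverse (real (Suc n))" for n
  have X: "X n > 0" for n by (simp add: X_def)
  have X0: "X \<longlonglongrightarrow> 0" unfolding X_def using LIMSEQ_inverse_real_of_nat .
  have "\<exists>a b a' b'. 0 < a \<and> a < X n \<and> 0 < b \<and> b < X n \<and> 0 < a' \<and> a' < X n \<and> 0 < b' \<and> b' < X n \<and>
     L (dir_deriv v (dir_deriv u f) (z + of_real a * u + of_real b * v)) = L (dir_deriv u (dir_deriv v f) (z + of_real a' * v + of_real b' * u))" for n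
  proof -
    obtain a b :: real where 1: "0 < a" "a < X n" "0 < b" "b < X n"
      "L (f (z + of_real (X n) * u + of_real (X n) * v)) - L (f (z + of_real (X n) * u)) - L (f (z + of_real (X n) * v)) + L (f z)
       = (X n)\<^sup>2 * L (dir_deriv v (dir_deriv u f) (z + of_real a * u + of_real b * v))"
      by (rule second_difference_mvt[OF assms X])
    obtain a' b' :: real where 2: "0 < a'" "a' < X n" "0 < b'" "b' < X n"
      "L (f (z + of_real (X n) * v + of_real (X n) * u)) - L (f (z + of_real (X n) * v)) - L (f (z + of_real (X n) * u)) + L (f z)
       = (X n)\<^sup>2 * L (dir_deriv u (dir_deriv v f) (z + of_real a' * v + of_real b' * u))"
      by (rule second_difference_mvt[OF assms X])
    have "(X n)\<^sup>2 * L (dir_deriv v (dir_deriv u f) (z + of_real a * u + of_real b * v)) =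
        (X n)\<^sup>2 * L (dir_deriv u (dir_deriv v f) (z + of_real a' * v + of_real b' * u))"
      using 1(5) 2(5) by (simp add: algebra_simps)
    with X[of n] 1 2 show ?thesis by auto
  qed
  then obtain a b a' b' where ab: "\<And>n. 0 < a n \<and> a n < X n \<and> 0 < b n \<and> b n < X n \<and> 0 < a' n \<and> a' n < X n \<and> 0 < b' n \<and> b' n < X n \<and>
     L (dir_deriv v (dir_deriv u f) (z + of_real (a n) * u + of_real (b n) * v)) = L (dir_deriv u (dir_deriv v f) (z + of_real (a' n) * v + of_real (b' n) * u))"
    by metis
  have lim: "c \<longlonglongrightarrow> 0" if "\<And>n. 0 < c n \<and> c n < X n" for c :: "nat \<Rightarrow> real"
    by (rule tendsto_sandwich[OF _ _ tendsto_const X0]) (use that less_imp_le in \<open>auto intro!: always_eventually\<close>)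
  have cont: "(\<lambda>n. L (g (y n))) \<longlonglongrightarrow> L (g z)" if "smooth g" "y \<longlonglongrightarrow> z" for g y
    by (rule bounded_linear.tendsto[OF assms(2)
          continuous_on_tendsto_compose[OF smooth_continuous[OF that(1), of UNIV] that(2)]]) simp_all
  have y: "(\<lambda>n. z + of_real (c n) * w + of_real (d n) * w') \<longlonglongrightarrow> z"
    if "c \<longlonglongrightarrow> 0" "d \<longlonglongrightarrow> 0" for c d :: "nat \<Rightarrow> real" and w w'
  proof -
    have "(\<lambda>n. z + of_real (c n) * w + of_real (d n) * w') \<longlonglongrightarrow> z + of_real 0 * w + of_real 0 * w'"
      by (intro tendsto_intros that)
    then show ?thesis by simp
  qed
  have "(\<lambda>n. L (dir_deriv v (dir_deriv u f) (z + of_real (a n) * u + of_real (b n) * v))) \<longlonglongrightarrow> L (dir_deriv v (dir_deriv u f) z)"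
    by (intro cont y smooth_dir_deriv assms lim) (use ab in auto)
  moreover have "(\<lambda>n. L (dir_deriv u (dir_deriv v f) (z + of_real (a' n) * v + of_real (b' n) * u))) \<longlonglongrightarrow> L (dir_deriv u (dir_deriv v f) z)"
    by (intro cont y smooth_dir_deriv assms lim) (use ab in auto)
  ultimately show ?thesis using ab LIMSEQ_unique by simp
qed

lemma dir_deriv_commute:
  assumes "smooth f"
  shows "dir_deriv u (dir_deriv v f) = dir_deriv v (dir_deriv u f)"
  using dir_deriv_commute_linear[OF assms bounded_linear_Re] dir_deriv_commute_linear[OF assms bounded_linear_Im]
  by (auto simp: complex_eq_iff)

section \<open>The fundamental lemma of the calculus of variations\<close>

lemma test_functionI:
  assumes "smooth \<phi>" "compact K" "K \<subseteq> \<Omega>" "\<And>z. z \<notin> K \<Longrightarrow> \<phi> z = 0"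
  shows "\<phi> \<in> test_functions \<Omega>"
proof -
  have "closure {z. \<phi> z \<noteq> 0} \<subseteq> K"
    using assms by (intro closure_minimal compact_imp_closed) auto
  then have "compact (closure {z. \<phi> z \<noteq> 0})"
    using assms(2) by (metis closed_closure compact_Int_closed inf.absorb2)
  then show ?thesis
    using assms \<open>closure _ \<subseteq> K\<close> by (auto simp: test_functions_def)
qed

lemma test_function_support:
  assumes "\<phi> \<in> test_functions \<Omega>"
  obtains K where "compact K" "K \<subseteq> \<Omega>" "\<And>z. z \<notin> K \<Longrightarrow> \<phi> z = 0"
  using assms closure_subset[of "{z. \<phi> z \<noteq> 0}"]
  by (intro that[of "closure {z. \<phi> z \<noteq> 0}"]) (auto simp: test_functions_def)

lemma test_function_smooth: "\<phi> \<in> test_functions \<Omega> \<Longrightarrow> smooth \<phi>"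
  by (simp add: test_functions_def)

lemma dir_deriv_zero_outside:
  assumes "closed K" "\<And>z. z \<notin> K \<Longrightarrow> f z = 0" "z \<notin> K"
  shows "dir_deriv v f z = 0"
proof (rule dir_deriv_eq)
  have "((\<lambda>z. 0) has_derivative (\<lambda>v. 0)) (at z)" by simp
  then show "(f has_derivative (\<lambda>v. 0)) (at z)"
    by (rule has_derivative_transform_within_open[of _ _ _ _ "- K"])
       (use assms in auto)
qed

lemma test_function_dir_deriv:
  assumes "\<phi> \<in> test_functions \<Omega>"
  shows "dir_deriv v \<phi> \<in> test_functions \<Omega>"
proof -
  obtain K where K: "compact K" "K \<subseteq> \<Omega>" "\<And>z. z \<notin> K \<Longrightarrow> \<phi> z = 0"
    using test_function_support[OF assms] by blast
  show ?thesis
    by (rule test_functionI[OF smooth_dir_deriv[OF test_function_smooth[OF assms]] K(1,2)])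
       (rule dir_deriv_zero_outside[OF compact_imp_closed[OF K(1)] K(3)])
qed

lemma test_function_bounded:
  assumes "\<phi> \<in> test_functions \<Omega>"
  obtains B where "B > 0" "\<And>z. cmod (\<phi> z) \<le> B"
proof -
  obtain K where K: "compact K" "K \<subseteq> \<Omega>" "\<And>z. z \<notin> K \<Longrightarrow> \<phi> z = 0"
    using test_function_support[OF assms] by blast
  have "bounded (\<phi> ` K)"
    using K(1) smooth_continuous[OF test_function_smooth[OF assms]]
    by (simp add: compact_continuous_image compact_imp_bounded)
  then obtain B where "B > 0" "\<forall>x\<in>\<phi> ` K. norm x \<le> B"
    using bounded_pos by blast
  then have "cmod (\<phi> z) \<le> B" for z
    using K(3)[of z] by (cases "z \<in> K") auto
  with \<open>B > 0\<close> show thesis using that by blast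
qed

text \<open>If \<beta> is smooth, nonnegative and positive exactly on the box, then
  \<open>1 - exp(- n * \<beta>)\<close> stays between 0 and 1, vanishes off the box and tends to 1
  on it.\<close>

lemma box_indicator_approximation:
  "\<exists>\<phi> :: nat \<Rightarrow> complex \<Rightarrow> complex. \<forall>n z. smooth (\<phi> n) \<and> (z \<notin> box a b \<longrightarrow> \<phi> n z = 0) \<and>
    cmod (\<phi> n z) \<le> 1 \<and> (\<lambda>n. \<phi> n z) \<longlonglongrightarrow> of_bool (z \<in> box a b)"
proof -
  \<comment> \<open>One flat factor for each of the four half-planes whose intersection is the box;
    multiplying by \<open>- \<i>\<close> turns the imaginary part into a real part, so that
    \<open>smooth_flat\<close> covers all four.\<close>
  define \<beta> where "\<beta> z = flat 1 (Re (z - a)) * flat 1 (Re (b - z)) *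
      (flat 1 (Re (- \<i> * (z - a))) * flat 1 (Re (- \<i> * (b - z))))" for z
  have nonneg: "\<beta> z \<ge> 0" for z by (simp add: \<beta>_def flat_def)
  have pos: "\<beta> z > 0 \<longleftrightarrow> z \<in> box a b" for z
    by (auto simp: \<beta>_def flat_def in_box_complex_iff zero_less_mult_iff split: if_splits)
  have "smooth (\<lambda>z. complex_of_real (\<beta> z))"
    unfolding \<beta>_def of_real_mult
    by (intro smooth_mult smooth_compose[OF smooth_flat] smooth_diff smooth_ident smooth_const)
  then have smooth: "smooth (\<lambda>z. 1 - exp (- (of_nat n * complex_of_real (\<beta> z))))" for n
    by (intro smooth_diff smooth_const smooth_compose[OF smooth_exp] smooth_minus smooth_mult)
  show ?thesis
  proof (intro exI[of _ "\<lambda>n z. complex_of_real (1 - exp (- (real n * \<beta> z)))"] allI conjI impI)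
    show "smooth (\<lambda>z. complex_of_real (1 - exp (- (real n * \<beta> z))))" for n
      using smooth[of n] by (simp flip: exp_of_real)
    show "complex_of_real (1 - exp (- (real n * \<beta> z))) = 0" if "z \<notin> box a b" for n z
      using that nonneg[of z] pos[of z] by simp
    show "cmod (complex_of_real (1 - exp (- (real n * \<beta> z)))) \<le> 1" for n z
      using nonneg[of z] by (simp only: norm_of_real) simp
    show "(\<lambda>n. complex_of_real (1 - exp (- (real n * \<beta> z)))) \<longlonglongrightarrow> of_bool (z \<in> box a b)" for z
    proof (cases "z \<in> box a b")
      case True
      then have "\<beta> z > 0" using pos by blast
      then have "filterlim (\<lambda>n. real n * \<beta> z) at_top sequentially"
        by (intro filterlim_at_top_mult_tendsto_pos[OF tendsto_const _ filterlim_real_sequentially]) auto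
      then have "(\<lambda>n. exp (- (real n * \<beta> z))) \<longlonglongrightarrow> 0"
        by (intro filterlim_compose[OF exp_at_bot]) (simp add: filterlim_uminus_at_bot)
      then have "(\<lambda>n. complex_of_real (1 - exp (- (real n * \<beta> z)))) \<longlonglongrightarrow> of_real (1 - 0)"
        by (intro tendsto_intros)
      then show ?thesis using True by simp
    next
      case False
      then have "\<beta> z = 0" using pos[of z] nonneg[of z] by simp
      then show ?thesis using False by simp
    qed
  qed
qed

section \<open>From vanishing integrals to functions vanishing almost everywhere\<close>

lemma lebesgue_on_vanishing_outside:
  fixes f :: "complex \<Rightarrow> complex"
  assumes "K \<in> sets lebesgue" "\<Omega> \<in> sets lebesgue" "K \<subseteq> \<Omega>" "\<And>z. z \<notin> K \<Longrightarrow> f z = 0"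
  shows "integrable (lebesgue_on \<Omega>) f \<longleftrightarrow> integrable (lebesgue_on K) f"
    and "(LINT z|lebesgue_on \<Omega>. f z) = (LINT z|lebesgue_on K. f z)"
proof -
  have "(\<lambda>x. indicat_real \<Omega> x *\<^sub>R f x) = f" "(\<lambda>x. indicat_real K x *\<^sub>R f x) = f"
    using assms(3,4) by (auto simp: indicator_def subset_eq fun_eq_iff)
  then show "integrable (lebesgue_on \<Omega>) f \<longleftrightarrow> integrable (lebesgue_on K) f"
    "(LINT z|lebesgue_on \<Omega>. f z) = (LINT z|lebesgue_on K. f z)"
    using assms(1,2) by (simp_all add: integrable_restrict_space integral_restrict_space)
qed

lemma sigma_finite_lebesgue: "sigma_finite_measure (lebesgue :: 'a::euclidean_space measure)"
proof
  obtain A :: "'a set set" where "countable A" "A \<subseteq> sets lborel" "\<Union>A = space lborel"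
    "\<forall>a\<in>A. emeasure lborel a \<noteq> \<infinity>"
    using lborel.sigma_finite_countable by blast
  then show "\<exists>A. countable A \<and> A \<subseteq> sets (lebesgue :: 'a measure) \<and> \<Union>A = space lebesgue \<and>
      (\<forall>a\<in>A. emeasure lebesgue a \<noteq> \<infinity>)"
    by (intro exI[of _ A]) (auto simp: subset_eq)
qed

text \<open>Boxes form an intersection-stable generator of the Borel sets, so a Dynkin induction
  extends the vanishing of the integrals to all Borel sets, and then to all Lebesgue sets. A
  function whose integral over every measurable set is zero vanishes almost everywhere.\<close>

lemma box_integrals_zero_imp_AE_zero:
  fixes G :: "complex \<Rightarrow> complex"
  assumes G: "integrable lebesgue G" and vanish: "\<And>x. x \<notin> box a b \<Longrightarrow> G x = 0"
    and zero: "\<And>c d. (LINT x:box c d|lebesgue. G x) = 0"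
  shows "AE x in lebesgue. G x = 0"
proof -
  have int: "set_integrable lebesgue A G" if "A \<in> sets lebesgue" for A
    using that G unfolding set_integrable_def by (rule integrable_mult_indicator)
  \<comment> \<open>The complement case of the induction needs the integral over the whole plane,
    which is itself a box integral because \<open>G\<close> lives in one box.\<close>
  have total: "(LINT x|lebesgue. G x) = 0"
  proof -
    have "(\<lambda>x. indicat_real (box a b) x *\<^sub>R G x) = G"
      using vanish by (auto simp: indicator_def fun_eq_iff)
    then show ?thesis using zero[of a b] by (simp add: set_lebesgue_integral_def)
  qed
  have sets_box: "sigma_sets UNIV (range (\<lambda>(c, d). box c d :: complex set)) = sets borel"
    by (simp add: borel_eq_box)
  have borel: "(LINT x:A|lebesgue. G x) = 0" if "A \<in> sets borel" for A
  proof -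
    have "Int_stable (range (\<lambda>(c, d). box c d :: complex set))"
      by (auto simp: Int_stable_def box_Int_box)
    moreover have "range (\<lambda>(c, d). box c d :: complex set) \<subseteq> Pow UNIV" by simp
    moreover have "A \<in> sigma_sets UNIV (range (\<lambda>(c, d). box c d))"
      using that by (simp add: borel_eq_box)
    ultimately show ?thesis
    proof (induction rule: sigma_sets_induct_disjoint)
      case (basic A)
      then show ?case using zero by auto
    next
      case empty
      then show ?case by (simp add: set_lebesgue_integral_def)
    next
      case (compl A)
      then have A: "A \<in> sets lebesgue" using sets_box by auto
      have "(LINT x:UNIV - A|lebesgue. G x) = (LINT x|lebesgue. G x - indicat_real A x *\<^sub>R G x)"
        unfolding set_lebesgue_integral_def
        by (rule Bochner_Integration.integral_cong) (auto simp: indicator_def)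
      also have "\<dots> = 0"
        using int[OF A] G total compl.IH
        by (simp add: Bochner_Integration.integral_diff set_integrable_def set_lebesgue_integral_def)
      finally show ?case .
    next
      case (union A)
      have "A i \<in> sets lebesgue" for i
        using union sets_box by auto
      then show ?case
        using union by (subst lebesgue_integral_countable_add) (auto simp: disjoint_family_on_def intro!: int)
    qed
  qed
  have "(LINT x:A|lebesgue. G x) = 0" if A: "A \<in> sets lebesgue" for A
  proof -
    \<comment> \<open>A Lebesgue set is an F-sigma set, hence Borel, up to a null set, which does
      not change the integral.\<close>
    obtain C T where CT: "fsigma C" "T \<in> null_sets lebesgue" "C \<union> T = A" "disjnt C T"
      using lebesgue_set_almost_fsigma[OF A] .
    have C: "C \<in> sets borel" using CT(1) by (cases rule: fsigma.cases) auto
    have "(LINT x:A|lebesgue. G x) = (LINT x:C|lebesgue. G x)"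
    proof (rule set_integral_cong_set)
      show "set_borel_measurable lebesgue C G" "set_borel_measurable lebesgue A G"
        using int[of C] int[of A] C A
        by (auto simp: set_integrable_def set_borel_measurable_def)
      show "AE x in lebesgue. (x \<in> C) = (x \<in> A)"
        using AE_not_in[OF CT(2)] CT(3) by auto
    qed
    then show ?thesis using borel[OF C] by simp
  qed
  then show ?thesis
    by (rule sigma_finite_measure.density_zero[OF sigma_finite_lebesgue G])
qed

text \<open>Inside a closed box contained in \<Omega>, the smooth approximations of box indicators
  are admissible test functions, and dominated convergence turns the hypothesis into vanishing
  integrals of \<open>g\<close> over all smaller boxes. Countably many closed boxes exhaust
  \<Omega>.\<close>

lemma fundamental_lemma:
  assumes \<Omega>: "open \<Omega>" and g: "locally_integrable \<Omega> g"
    and zero: "\<And>\<phi>. \<phi> \<in> test_functions \<Omega> \<Longrightarrow> distr_of \<Omega> g \<phi> = 0"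
  shows "AE x in lebesgue_on \<Omega>. g x = 0"
proof -
  have box: "AE x in lebesgue. x \<in> cbox a b \<longrightarrow> g x = 0" if ab: "cbox a b \<subseteq> \<Omega>" for a b
  proof -
    let ?gK = "\<lambda>x. if x \<in> cbox a b then g x else 0"
    have gK: "integrable lebesgue ?gK"
      using g ab unfolding locally_integrable_def
      by (subst Lebesgue_Measure.integrable_restrict_UNIV) (auto simp: compact_cbox)
    \<comment> \<open>Cutting to the open box matches the approximants, which vanish off open boxes;
      the frontier lost here is negligible and is restored at the end.\<close>
    define G where "G x = indicat_real (box a b) x *\<^sub>R ?gK x" for x
    have "AE x in lebesgue. G x = 0"
    proof (rule box_integrals_zero_imp_AE_zero)
      show "integrable lebesgue G"
        unfolding G_def by (rule integrable_mult_indicator[OF _ gK]) auto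
      show "G x = 0" if "x \<notin> box a b" for x using that by (simp add: G_def)
      fix c d
      \<comment> \<open>An arbitrary box meets the fixed one in a box again, so the cutoffs needed
        are those of \<open>box_indicator_approximation\<close> and have support in the closed
        box.\<close>
      obtain c' d' where B: "box c d \<inter> box a b = box c' d'" using box_Int_box by blast
      have sub: "box c' d' \<subseteq> cbox a b" using B box_subset_cbox by blast
      obtain \<phi> :: "nat \<Rightarrow> complex \<Rightarrow> complex" where \<phi>: "\<And>n. smooth (\<phi> n)" "\<And>n z. z \<notin> box c' d' \<Longrightarrow> \<phi> n z = 0"
        "\<And>n z. cmod (\<phi> n z) \<le> 1" "\<And>z. (\<lambda>n. \<phi> n z) \<longlonglongrightarrow> of_bool (z \<in> box c' d')"
        using box_indicator_approximation[of c' d'] by metis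
      have test: "\<phi> n \<in> test_functions \<Omega>" for n
        using \<phi>(1) compact_cbox ab by (rule test_functionI) (use \<phi>(2) sub in blast)
      have meas: "(\<lambda>x. ?gK x * \<phi> n x) \<in> borel_measurable lebesgue" for n
        using borel_measurable_integrable[OF gK] smooth_continuous[OF \<phi>(1), of UNIV n]
        by (intro borel_measurable_times)
           (auto simp: measurable_completion borel_measurable_continuous_onI)
      have "(\<lambda>n. LINT x|lebesgue. ?gK x * \<phi> n x) \<longlonglongrightarrow>
          (LINT x|lebesgue. ?gK x * of_bool (x \<in> box c' d'))"
      proof (rule integral_dominated_convergence)
        show "integrable lebesgue (\<lambda>x. norm (?gK x))" using gK by (rule integrable_norm)
        show "AE x in lebesgue. (\<lambda>n. ?gK x * \<phi> n x) \<longlonglongrightarrow> ?gK x * of_bool (x \<in> box c' d')"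
          using \<phi>(4) by (intro AE_I2 tendsto_mult tendsto_const)
        show "AE x in lebesgue. cmod (?gK x * \<phi> n x) \<le> norm (?gK x)" for n
          using \<phi>(3) by (intro AE_I2) (simp add: norm_mult mult_left_le)
        show "(\<lambda>x. ?gK x * of_bool (x \<in> box c' d')) \<in> borel_measurable lebesgue"
          by (rule borel_measurable_LIMSEQ_metric[OF meas])
             (rule tendsto_mult[OF tendsto_const \<phi>(4)])
      qed (rule meas)
      moreover have "(LINT x|lebesgue. ?gK x * \<phi> n x) = 0" for n
      proof -
        have "(LINT x|lebesgue. ?gK x * \<phi> n x) = (LINT x|lebesgue_on UNIV. g x * \<phi> n x)"
          using \<phi>(2)[of _ n] sub unfolding lebesgue_on_UNIV_eq
          by (intro Bochner_Integration.integral_cong) auto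
        also have "\<dots> = (LINT x|lebesgue_on \<Omega>. g x * \<phi> n x)"
          using \<Omega> \<phi>(2)[of _ n] sub ab by (intro lebesgue_on_vanishing_outside) auto
        finally show ?thesis using zero[OF test] by (simp add: distr_of_def)
      qed
      ultimately have "(LINT x|lebesgue. ?gK x * of_bool (x \<in> box c' d')) = 0"
        by (simp add: LIMSEQ_const_iff)
      moreover have "indicat_real (box c d) x *\<^sub>R G x = ?gK x * of_bool (x \<in> box c' d')" for x
        using B by (auto simp: G_def indicator_def)
      ultimately show "(LINT x:box c d|lebesgue. G x) = 0"
        by (simp add: set_lebesgue_integral_def)
    qed
    moreover have "AE x in lebesgue. x \<notin> cbox a b - box a b"
      by (rule AE_not_in) (simp add: negligible_frontier_interval flip: negligible_iff_null_sets)
    ultimately show ?thesis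
      by eventually_elim (auto simp: G_def)
  qed
  obtain \<D> where \<D>: "countable \<D>" "\<D> \<subseteq> Pow \<Omega>" "\<And>X. X \<in> \<D> \<Longrightarrow> \<exists>a b. X = cbox a b" "\<Union>\<D> = \<Omega>"
    using open_countable_Union_open_cbox[OF \<Omega>] by metis
  have "AE x in lebesgue. \<forall>X\<in>\<D>. x \<in> X \<longrightarrow> g x = 0"
    using box \<D>(2,3) by (intro AE_ball_countable'[OF _ \<D>(1)]) blast
  then show ?thesis
    using \<Omega> \<D>(4) by (subst AE_restrict_space_iff) auto
qed

section \<open>Pairings with test functions and uniqueness of weak derivatives\<close>

lemma locally_integrable_mult_continuous:
  assumes g: "locally_integrable \<Omega> g" and \<phi>: "continuous_on UNIV \<phi>"
  shows "locally_integrable \<Omega> (\<lambda>z. g z * \<phi> z)"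
  unfolding locally_integrable_def
proof (intro allI impI)
  fix K assume K: "compact K \<and> K \<subseteq> \<Omega>"
  obtain B where B: "\<And>z. z \<in> K \<Longrightarrow> cmod (\<phi> z) \<le> B"
    using compact_imp_bounded[OF compact_continuous_image[OF continuous_on_subset[OF \<phi>] conjunct1[OF K]]]
    by (auto simp: bounded_iff)
  have gK: "integrable (lebesgue_on K) g" using g K by (simp add: locally_integrable_def)
  have \<phi>K: "\<phi> \<in> borel_measurable (lebesgue_on K)"
    using K continuous_on_subset[OF \<phi>]
    by (intro continuous_imp_measurable_on_sets_lebesgue) (auto simp: compact_imp_closed)
  show "integrable (lebesgue_on K) (\<lambda>z. g z * \<phi> z)"
  proof (rule Bochner_Integration.integrable_bound)
    show "integrable (lebesgue_on K) (\<lambda>z. B * norm (g z))"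
      using gK by (intro integrable_mult_right integrable_norm)
    show "(\<lambda>z. g z * \<phi> z) \<in> borel_measurable (lebesgue_on K)"
      using gK \<phi>K by (intro borel_measurable_times) auto
    show "AE z in lebesgue_on K. norm (g z * \<phi> z) \<le> norm (B * norm (g z))"
    proof (rule AE_I2)
      fix z assume "z \<in> space (lebesgue_on K)"
      then have "cmod (\<phi> z) \<le> B" using B by simp
      then show "norm (g z * \<phi> z) \<le> norm (B * norm (g z))"
        using norm_ge_zero[of "\<phi> z"] by (simp add: norm_mult abs_mult mult.commute mult_right_mono)
    qed
  qed
qed

lemma distr_of_integrable:
  assumes "open \<Omega>" "locally_integrable \<Omega> g" "\<phi> \<in> test_functions \<Omega>"
  shows "integrable (lebesgue_on \<Omega>) (\<lambda>z. g z * \<phi> z)"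
proof -
  obtain K where K: "compact K" "K \<subseteq> \<Omega>" "\<And>z. z \<notin> K \<Longrightarrow> \<phi> z = 0"
    using test_function_support[OF assms(3)] by blast
  have "locally_integrable \<Omega> (\<lambda>z. g z * \<phi> z)"
    using assms(2) smooth_continuous[OF test_function_smooth[OF assms(3)]]
    by (rule locally_integrable_mult_continuous)
  then have "integrable (lebesgue_on K) (\<lambda>z. g z * \<phi> z)"
    using K by (simp add: locally_integrable_def)
  then show ?thesis
    using assms(1) K by (subst lebesgue_on_vanishing_outside(1)[of K]) (auto simp: compact_imp_closed)
qed

text \<open>This makes the arbitrary choice in \<open>weak_deriv\<close> harmless: under an integral
  the chosen representative may be replaced by any weak derivative that has been computed
  explicitly.\<close>

lemma has_weak_deriv_unique:
  assumes \<Omega>: "open \<Omega>" and g: "has_weak_deriv \<Omega> v f g" "has_weak_deriv \<Omega> v f g'"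
  shows "AE z in lebesgue_on \<Omega>. g z = g' z"
proof -
  have l: "locally_integrable \<Omega> g" "locally_integrable \<Omega> g'"
    using g by (auto simp: has_weak_deriv_def)
  have "AE z in lebesgue_on \<Omega>. g z - g' z = 0"
  proof (rule fundamental_lemma[OF \<Omega>])
    show "locally_integrable \<Omega> (\<lambda>z. g z - g' z)"
      using l by (simp add: locally_integrable_def)
    fix \<phi> assume \<phi>: "\<phi> \<in> test_functions \<Omega>"
    have "distr_of \<Omega> g \<phi> = distr_of \<Omega> g' \<phi>"
      using g \<phi> by (auto simp: has_weak_deriv_def)
    then show "distr_of \<Omega> (\<lambda>z. g z - g' z) \<phi> = 0"
      using distr_of_integrable[OF \<Omega> l(1) \<phi>] distr_of_integrable[OF \<Omega> l(2) \<phi>]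
      by (simp add: distr_of_def left_diff_distrib)
  qed
  then show ?thesis by simp
qed

text \<open>Local integrability gives measurability only on compact subsets; a countable cover of
  \<Omega> by closed boxes glues these together.\<close>

lemma locally_integrable_measurable:
  assumes \<Omega>: "open \<Omega>" and g: "locally_integrable \<Omega> g"
  shows "g \<in> borel_measurable (lebesgue_on \<Omega>)"
proof -
  obtain \<D> where \<D>: "countable \<D>" "\<D> \<subseteq> Pow \<Omega>" "\<And>X. X \<in> \<D> \<Longrightarrow> \<exists>a b. X = cbox a b" "\<Union>\<D> = \<Omega>"
    using open_countable_Union_open_cbox[OF \<Omega>] by metis
  have "g \<in> borel_measurable (restrict_space (lebesgue_on \<Omega>) X)" if X: "X \<in> \<D>" for X
  proof -
    obtain a b where "X = cbox a b" using \<D>(3)[OF X] by blast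
    have "X \<subseteq> \<Omega>" using \<D>(2) X by blast
    then have "g \<in> borel_measurable (lebesgue_on X)"
      using g[unfolded locally_integrable_def, rule_format, of X] \<open>X \<subseteq> \<Omega>\<close> compact_cbox[of a b]
      by (intro borel_measurable_integrable) (simp add: \<open>X = cbox a b\<close>)
    moreover have "restrict_space (lebesgue_on \<Omega>) X = lebesgue_on X"
      using \<open>X \<subseteq> \<Omega>\<close> \<open>X = cbox a b\<close> \<Omega> by (subst restrict_restrict_space) (auto simp: inf.absorb2)
    ultimately show ?thesis by simp
  qed
  moreover have "X \<inter> space (lebesgue_on \<Omega>) \<in> sets (lebesgue_on \<Omega>)" if X: "X \<in> \<D>" for X
  proof -
    have "X \<in> sets lebesgue" using \<D>(3)[OF X] by auto
    then show ?thesis by (auto simp: sets_restrict_space)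
  qed
  ultimately show ?thesis
    using \<D>(4) by (simp add: measurable_piecewise_restrict_iff[OF \<D>(1)])
qed

section \<open>Change of variables in the complex plane\<close>

text \<open>The substitution theorem \<open>has_absolute_integral_change_of_variables\<close> is
  applied in \<open>real^2\<close>, where the Jacobian is the determinant of a matrix. These two
  maps carry it to the complex plane.\<close>

definition vec_of_complex :: "complex \<Rightarrow> real^2" where
  "vec_of_complex z = vector [Re z, Im z]"

definition complex_of_vec :: "real^2 \<Rightarrow> complex" where
  "complex_of_vec w = Complex (w $ 1) (w $ 2)"

lemma complex_vec_inverse [simp]:
  "complex_of_vec (vec_of_complex z) = z" "vec_of_complex (complex_of_vec w) = w"
  by (simp_all add: vec_of_complex_def complex_of_vec_def vec_eq_iff forall_2)

lemma bounded_linear_vec_of_complex: "bounded_linear vec_of_complex"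
  by (intro linear_conv_bounded_linear[THEN iffD1] linearI)
     (simp_all add: vec_of_complex_def vec_eq_iff forall_2)

lemma bounded_linear_complex_of_vec: "bounded_linear complex_of_vec"
  by (intro linear_conv_bounded_linear[THEN iffD1] linearI)
     (simp_all add: complex_of_vec_def complex_eq_iff)

lemma bounded_linear_borel_measurable:
  "bounded_linear (f :: 'a::euclidean_space \<Rightarrow> 'b::euclidean_space) \<Longrightarrow> f \<in> borel_measurable borel"
  by (simp add: bounded_linear.linear linear_continuous_on borel_measurable_continuous_onI)

lemma prod_Basis_vec2: "(\<Prod>b\<in>(Basis :: (real^2) set). w \<bullet> b) = (w $ 1) * (w $ 2)"
proof -
  have B: "(Basis :: (real^2) set) = {axis 1 1, axis 2 1}"
    by (auto simp: Basis_vec_def UNIV_2)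
  have "axis 1 1 \<noteq> (axis 2 1 :: real^2)" by (simp add: axis_eq_axis)
  then show ?thesis by (simp add: B inner_axis)
qed

text \<open>The preimage of a box is a box with the same side lengths, and Lebesgue-Borel measure is
  determined by the measures of boxes.\<close>

lemma distr_lborel_vec_of_complex: "distr lborel borel vec_of_complex = lborel"
proof (rule lborel_eqI[symmetric])
  fix l u :: "real^2" assume lu: "\<And>b. b \<in> Basis \<Longrightarrow> l \<bullet> b \<le> u \<bullet> b"
  have le: "l $ i \<le> u $ i" for i
    using lu[OF axis_in_Basis_iff[THEN iffD2], of 1 i] by (simp add: inner_axis)
  have "vec_of_complex -` box l u = box (complex_of_vec l) (complex_of_vec u)"
    by (auto simp: box_vec_eq_empty mem_box_cart in_box_complex_iff vec_of_complex_def complex_of_vec_def forall_2)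
  moreover have "emeasure lborel (box (complex_of_vec l) (complex_of_vec u)) = (u $ 1 - l $ 1) * (u $ 2 - l $ 2)"
    using le by (subst emeasure_lborel_box) (auto simp: Basis_complex_def complex_of_vec_def)
  ultimately show "emeasure (distr lborel borel vec_of_complex) (box l u) = (\<Prod>b\<in>Basis. (u - l) \<bullet> b)"
    using bounded_linear_borel_measurable[OF bounded_linear_vec_of_complex]
    by (subst emeasure_distr) (auto simp: prod_Basis_vec2)
qed simp

lemma distr_lborel_complex_of_vec: "distr lborel borel complex_of_vec = lborel"
proof -
  have "distr lborel borel complex_of_vec = distr (distr lborel borel vec_of_complex) borel complex_of_vec"
    by (simp add: distr_lborel_vec_of_complex)
  also have "\<dots> = distr lborel borel (complex_of_vec \<circ> vec_of_complex)"
    using bounded_linear_borel_measurable[OF bounded_linear_vec_of_complex]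
      bounded_linear_borel_measurable[OF bounded_linear_complex_of_vec]
    by (intro distr_distr) auto
  also have "\<dots> = lborel" by (simp add: o_def distr_id2)
  finally show ?thesis .
qed

text \<open>Preserving the Borel measure makes preimages of null sets null, so both measurability
  and the image measure pass to the completion.\<close>

lemma lborel_preserving_imp_lebesgue:
  fixes T :: "'a::euclidean_space \<Rightarrow> 'b::euclidean_space"
  assumes T: "T \<in> borel_measurable borel" and d: "distr lborel borel T = lborel"
  shows "T \<in> lebesgue \<rightarrow>\<^sub>M lebesgue" and "distr lebesgue lebesgue T = lebesgue"
proof -
  have T': "T \<in> lebesgue \<rightarrow>\<^sub>M lborel" using T by (simp add: measurable_completion)
  have d': "distr lebesgue lborel T = lborel"
    using T d by (subst distr_completion) (auto cong: distr_cong)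
  show "T \<in> lebesgue \<rightarrow>\<^sub>M lebesgue"
    using T' by (rule completion.measurable_completion2) (simp add: d')
  show "distr lebesgue lebesgue T = lebesgue"
    using completion.completion_distr_eq[OF T'] by (simp add: d')
qed

lemmas vec_of_complex_lebesgue = lborel_preserving_imp_lebesgue[OF
    bounded_linear_borel_measurable[OF bounded_linear_vec_of_complex] distr_lborel_vec_of_complex]
lemmas complex_of_vec_lebesgue = lborel_preserving_imp_lebesgue[OF
    bounded_linear_borel_measurable[OF bounded_linear_complex_of_vec] distr_lborel_complex_of_vec]

text \<open>Arguments and values are both transferred, because the functions integrated in the
  \<open>real^2\<close> substitution theorem also take values in \<open>real^2\<close>.\<close>

lemma has_bochner_integral_complex_of_vec:
  "has_bochner_integral lebesgue (\<lambda>w. vec_of_complex (f (complex_of_vec w))) (vec_of_complex x)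
     \<longleftrightarrow> has_bochner_integral lebesgue f x"
proof
  assume "has_bochner_integral lebesgue f x"
  then have "has_bochner_integral lebesgue (\<lambda>w. f (complex_of_vec w)) x"
    using complex_of_vec_lebesgue(1) borel_measurable_integrable[of lebesgue f]
      integrable_distr_eq[of complex_of_vec lebesgue lebesgue f]
      integral_distr[of complex_of_vec lebesgue lebesgue f]
    by (simp add: has_bochner_integral_iff complex_of_vec_lebesgue(2))
  then show "has_bochner_integral lebesgue (\<lambda>w. vec_of_complex (f (complex_of_vec w))) (vec_of_complex x)"
    using has_bochner_integral_bounded_linear[OF bounded_linear_vec_of_complex] by blast
next
  assume "has_bochner_integral lebesgue (\<lambda>w. vec_of_complex (f (complex_of_vec w))) (vec_of_complex x)"
  then have "has_bochner_integral lebesgue (\<lambda>w. complex_of_vec (vec_of_complex (f (complex_of_vec w)))) (complex_of_vec (vec_of_complex x))"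
    by (rule has_bochner_integral_bounded_linear[OF bounded_linear_complex_of_vec])
  then have "has_bochner_integral lebesgue (\<lambda>w. f (complex_of_vec (vec_of_complex w))) x"
    using vec_of_complex_lebesgue(1) borel_measurable_integrable[of lebesgue "\<lambda>w. f (complex_of_vec w)"]
      integrable_distr_eq[of vec_of_complex lebesgue lebesgue "\<lambda>w. f (complex_of_vec w)"]
      integral_distr[of vec_of_complex lebesgue lebesgue "\<lambda>w. f (complex_of_vec w)"]
    by (simp add: has_bochner_integral_iff vec_of_complex_lebesgue(2))
  then show "has_bochner_integral lebesgue f x" by simp
qed

text \<open>The signed determinant of \<open>L\<close> as a real linear map of the plane: the
  columns of its matrix are \<open>L 1\<close> and \<open>L \<i>\<close>.\<close>

definition jacobian :: "(complex \<Rightarrow> complex) \<Rightarrow> real" where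
  "jacobian L = Re (L 1) * Im (L \<i>) - Im (L 1) * Re (L \<i>)"

lemma set_integral_vec_transfer:
  fixes f :: "complex \<Rightarrow> complex"
  shows "(set_integrable lebesgue (vec_of_complex ` S) (\<lambda>w. vec_of_complex (f (complex_of_vec w))) \<and>
      set_lebesgue_integral lebesgue (vec_of_complex ` S) (\<lambda>w. vec_of_complex (f (complex_of_vec w))) = vec_of_complex b)
    \<longleftrightarrow> (set_integrable lebesgue S f \<and> set_lebesgue_integral lebesgue S f = b)"
proof -
  have "indicat_real (vec_of_complex ` S) w *\<^sub>R vec_of_complex (f (complex_of_vec w)) =
     vec_of_complex (indicat_real S (complex_of_vec w) *\<^sub>R f (complex_of_vec w))" for w
  proof -
    have "w \<in> vec_of_complex ` S \<longleftrightarrow> complex_of_vec w \<in> S"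
      by (metis complex_vec_inverse image_iff)
    then show ?thesis
      using linear_scale[OF bounded_linear.linear[OF bounded_linear_vec_of_complex]]
      by (simp add: indicator_def)
  qed
  then show ?thesis
    using has_bochner_integral_complex_of_vec[of "\<lambda>x. indicat_real S x *\<^sub>R f x" b]
    by (simp add: set_integrable_def set_lebesgue_integral_def has_bochner_integral_iff)
qed

text \<open>Conjugating \<open>g\<close> with the identification of the plane and
  \<open>real^2\<close> leaves injectivity intact and turns the matrix determinant into
  \<open>jacobian\<close>; the integrals on both sides are then carried back.\<close>

lemma has_absolute_integral_change_of_variables_complex:
  fixes f g :: "complex \<Rightarrow> complex"
  assumes S: "S \<in> sets lebesgue"
    and der: "\<And>x. x \<in> S \<Longrightarrow> (g has_derivative g' x) (at x)"
    and inj: "inj_on g S"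
  shows "(set_integrable lebesgue S (\<lambda>x. \<bar>jacobian (g' x)\<bar> *\<^sub>R f (g x)) \<and>
           set_lebesgue_integral lebesgue S (\<lambda>x. \<bar>jacobian (g' x)\<bar> *\<^sub>R f (g x)) = b)
     \<longleftrightarrow> (set_integrable lebesgue (g ` S) f \<and> set_lebesgue_integral lebesgue (g ` S) f = b)"
proof -
  define G where "G w = vec_of_complex (g (complex_of_vec w))" for w
  define G' where "G' w = (\<lambda>v. vec_of_complex (g' (complex_of_vec w) (complex_of_vec v)))" for w
  let ?F = "\<lambda>w. vec_of_complex (f (complex_of_vec w))"
  have S': "vec_of_complex ` S \<in> sets lebesgue"
  proof -
    have "vec_of_complex ` S = complex_of_vec -` S \<inter> space lebesgue"
      by (auto simp: image_iff) (metis complex_vec_inverse(2))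
    then show ?thesis using measurable_sets[OF complex_of_vec_lebesgue(1) S] by simp
  qed
  have der': "(G has_derivative G' w) (at w within vec_of_complex ` S)" if "w \<in> vec_of_complex ` S" for w
  proof -
    have "((\<lambda>w. g (complex_of_vec w)) has_derivative (\<lambda>v. g' (complex_of_vec w) (complex_of_vec v))) (at w)"
      by (rule has_derivative_compose[OF bounded_linear_imp_has_derivative[OF bounded_linear_complex_of_vec] der])
         (use that in auto)
    then show ?thesis
      unfolding G_def G'_def
      by (rule has_derivative_at_withinI[OF bounded_linear.has_derivative[OF bounded_linear_vec_of_complex]])
  qed
  have inj': "inj_on G (vec_of_complex ` S)"
    using inj by (auto simp: inj_on_def G_def) (metis complex_vec_inverse(1))
  have det: "det (matrix (G' w)) = jacobian (g' (complex_of_vec w))" for w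
  proof -
    have "complex_of_vec (axis 1 1) = 1" "complex_of_vec (axis 2 1) = \<i>"
      by (simp_all add: complex_of_vec_def complex_eq_iff axis_def)
    then show ?thesis
      by (simp add: det_2 matrix_def G'_def jacobian_def vec_of_complex_def)
  qed
  have eq: "(h absolutely_integrable_on A \<and> integral A h = c) \<longleftrightarrow> (set_integrable lebesgue A h \<and> set_lebesgue_integral lebesgue A h = c)"
    for h :: "real^2 \<Rightarrow> real^2" and A c
    using set_lebesgue_integral_eq_integral(2)[of A h] by auto
  have J: "\<bar>det (matrix (G' w))\<bar> *\<^sub>R ?F (G w) =
      vec_of_complex (\<bar>jacobian (g' (complex_of_vec w))\<bar> *\<^sub>R f (g (complex_of_vec w)))" for w
    using linear_scale[OF bounded_linear.linear[OF bounded_linear_vec_of_complex]]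
    by (simp add: det G_def)
  have img: "G ` vec_of_complex ` S = vec_of_complex ` g ` S"
    by (auto simp: G_def image_iff)
  let ?H = "\<lambda>x. \<bar>jacobian (g' x)\<bar> *\<^sub>R f (g x)"
  have "(set_integrable lebesgue (vec_of_complex ` S) (\<lambda>w. vec_of_complex (?H (complex_of_vec w))) \<and>
      set_lebesgue_integral lebesgue (vec_of_complex ` S) (\<lambda>w. vec_of_complex (?H (complex_of_vec w))) = vec_of_complex b)
    \<longleftrightarrow> (set_integrable lebesgue (vec_of_complex ` g ` S) ?F \<and>
      set_lebesgue_integral lebesgue (vec_of_complex ` g ` S) ?F = vec_of_complex b)"
    using has_absolute_integral_change_of_variables[OF S' der' inj', of ?F "vec_of_complex b"]
    by (simp only: eq J img)
  then show ?thesis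
    by (simp only: set_integral_vec_transfer[of S ?H] set_integral_vec_transfer[of "g ` S" f])
qed

lemma change_of_variables_complex:
  fixes f g :: "complex \<Rightarrow> complex"
  assumes S: "S \<in> sets lebesgue" "g ` S \<in> sets lebesgue"
    and der: "\<And>x. x \<in> S \<Longrightarrow> (g has_derivative g' x) (at x)"
    and inj: "inj_on g S"
  shows "integrable (lebesgue_on (g ` S)) f \<longleftrightarrow>
      integrable (lebesgue_on S) (\<lambda>x. of_real \<bar>jacobian (g' x)\<bar> * f (g x))" (is "?A \<longleftrightarrow> ?B")
    and "(LINT x|lebesgue_on (g ` S). f x) = (LINT x|lebesgue_on S. of_real \<bar>jacobian (g' x)\<bar> * f (g x))"
proof -
  have *: "set_integrable lebesgue T h \<longleftrightarrow> integrable (lebesgue_on T) h"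
     "set_lebesgue_integral lebesgue T h = (LINT x|lebesgue_on T. h x)"
    if "T \<in> sets lebesgue" for T and h :: "complex \<Rightarrow> complex"
    using that by (simp_all add: set_integrable_def set_lebesgue_integral_def integrable_restrict_space
        integral_restrict_space)
  note cov = has_absolute_integral_change_of_variables_complex[OF S(1) der inj, of f,
      unfolded *[OF S(1)] *[OF S(2)] scaleR_conv_of_real]
  show i: "?A \<longleftrightarrow> ?B" using cov by blast
  show "(LINT x|lebesgue_on (g ` S). f x) = (LINT x|lebesgue_on S. of_real \<bar>jacobian (g' x)\<bar> * f (g x))"
    \<comment> \<open>If one side is not integrable then neither is the other, and both Bochner
      integrals take the default value 0.\<close>
    using cov i not_integrable_integral_eq by (metis (no_types, lifting))
qed

section \<open>Weak derivatives under a diffeomorphism\<close>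

lemma dir_deriv_mult:
  assumes "smooth f" "smooth g"
  shows "dir_deriv v (\<lambda>z. f z * g z) z = f z * dir_deriv v g z + dir_deriv v f z * g z"
  by (rule dir_deriv_eq[OF has_derivative_mult[OF assms[THEN smooth_has_derivative]]])

lemma dir_deriv_bounded_linear:
  assumes "smooth f" "bounded_linear L"
  shows "dir_deriv v (\<lambda>z. L (f z)) z = L (dir_deriv v f z)"
  by (rule dir_deriv_eq[OF bounded_linear.has_derivative[OF assms(2) smooth_has_derivative[OF assms(1)]]])

lemma dir_deriv_compose:
  assumes "smooth f" "smooth g"
  shows "dir_deriv v (\<lambda>z. f (g z)) z =
    Re (dir_deriv v g z) * dir_deriv 1 f (g z) + Im (dir_deriv v g z) * dir_deriv \<i> f (g z)"
  using dir_deriv_eq[OF has_derivative_compose[OF smooth_has_derivative[OF assms(2)] smooth_has_derivative[OF assms(1)]]]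
    dir_deriv_linear[OF assms(1)] by metis

text \<open>Positivity of the Jacobian removes the absolute value in the substitution rule.
  Properness uses preimages in the whole plane, so that pulling back a test function, already
  extended by zero, yields a test function.\<close>

locale domain_diffeo =
  fixes \<Omega> :: "complex set" and \<Phi> :: "complex \<Rightarrow> complex"
  assumes open_domain: "open \<Omega>"
    and smooth_map: "smooth \<Phi>"
    and bij: "bij_betw \<Phi> \<Omega> \<Omega>"
    and jac_pos: "jacobian (\<lambda>v. dir_deriv v \<Phi> z) > 0"
    and proper: "compact K \<Longrightarrow> K \<subseteq> \<Omega> \<Longrightarrow> compact (\<Phi> -` K) \<and> \<Phi> -` K \<subseteq> \<Omega>"
begin

definition J :: "complex \<Rightarrow> real" where "J z = jacobian (\<lambda>v. dir_deriv v \<Phi> z)"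

lemma continuous_J: "continuous_on UNIV (\<lambda>z. complex_of_real (J z))"
  unfolding J_def jacobian_def
  by (intro continuous_intros smooth_continuous[OF smooth_dir_deriv[OF smooth_map]])

lemma change_of_variables:
  fixes f :: "complex \<Rightarrow> complex"
  assumes "S \<in> sets lebesgue" "S \<subseteq> \<Omega>" "\<Phi> ` S \<in> sets lebesgue"
  shows "integrable (lebesgue_on (\<Phi> ` S)) f \<longleftrightarrow> integrable (lebesgue_on S) (\<lambda>z. J z * f (\<Phi> z))"
    and "(LINT z|lebesgue_on (\<Phi> ` S). f z) = (LINT z|lebesgue_on S. J z * f (\<Phi> z))"
proof -
  have J: "J z = \<bar>jacobian (\<lambda>v. dir_deriv v \<Phi> z)\<bar>" for z
    using jac_pos[of z] by (simp add: J_def)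
  have inj: "inj_on \<Phi> S" using bij assms(2) by (metis bij_betw_imp_inj_on inj_on_subset)
  note cov = change_of_variables_complex[OF assms(1,3) smooth_has_derivative[OF smooth_map] inj, of f]
  show "integrable (lebesgue_on (\<Phi> ` S)) f \<longleftrightarrow> integrable (lebesgue_on S) (\<lambda>z. J z * f (\<Phi> z))"
    using cov(1) unfolding J .
  show "(LINT z|lebesgue_on (\<Phi> ` S). f z) = (LINT z|lebesgue_on S. J z * f (\<Phi> z))"
    using cov(2) unfolding J .
qed

lemma image_domain: "\<Phi> ` \<Omega> = \<Omega>"
  using bij by (simp add: bij_betw_def)

lemma domain_lebesgue: "\<Omega> \<in> sets lebesgue"
  using open_domain by simp

lemmas change_of_variables_domain =
  change_of_variables[OF domain_lebesgue order_refl, unfolded image_domain, OF domain_lebesgue]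

lemma test_function_compose:
  assumes "\<phi> \<in> test_functions \<Omega>"
  shows "(\<lambda>z. \<phi> (\<Phi> z)) \<in> test_functions \<Omega>"
proof -
  obtain K where K: "compact K" "K \<subseteq> \<Omega>" "\<And>z. z \<notin> K \<Longrightarrow> \<phi> z = 0"
    using test_function_support[OF assms] by blast
  show ?thesis
    by (rule test_functionI[OF smooth_compose[OF test_function_smooth[OF assms] smooth_map]
          conjunct1[OF proper[OF K(1,2)]] conjunct2[OF proper[OF K(1,2)]]])
       (use K(3) in simp)
qed

text \<open>Substituting \<Phi> turns the integral of \<open>f\<close> over a compact
  \<open>K\<close> into that of \<open>g\<close> over the preimage of \<open>K\<close>, which is
  again compact and inside \<Omega> by properness.\<close>

lemma locally_integrable_transfer:
  fixes f g :: "complex \<Rightarrow> complex"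
  assumes "locally_integrable \<Omega> g" "\<And>z. z \<in> \<Omega> \<Longrightarrow> J z * f (\<Phi> z) = g z"
  shows "locally_integrable \<Omega> f"
  unfolding locally_integrable_def
proof (intro allI impI)
  fix K assume K: "compact K \<and> K \<subseteq> \<Omega>"
  let ?L = "\<Phi> -` K"
  have L: "compact ?L" "?L \<subseteq> \<Omega>" using proper[of K] K by auto
  have img: "\<Phi> ` ?L = K"
    using K image_domain by (metis image_vimage_eq inf.absorb_iff1 image_mono subset_UNIV subset_trans)
  have "integrable (lebesgue_on ?L) g"
    using assms(1) L by (simp add: locally_integrable_def)
  then have "integrable (lebesgue_on ?L) (\<lambda>z. J z * f (\<Phi> z))"
    by (rule Bochner_Integration.integrable_cong[OF refl, THEN iffD1, rotated])
       (use L(2) assms(2) in auto)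
  then show "integrable (lebesgue_on K) f"
    using change_of_variables(1)[of ?L f] L K unfolding img by (auto simp: compact_imp_closed)
qed

text \<open>The integral of \<open>H\<close> against the derivative of \<phi> is pulled back by
  \<Phi>. The hypothesis \<open>piola\<close> writes the pulled-back integrand as \<open>h\<close>
  times a divergence, so the weak derivatives of \<open>h\<close> apply with the test functions
  \<open>a * \<psi>\<close> and \<open>b * \<psi>\<close>; a second substitution returns to
  \<open>G\<close>. Here \<open>a\<close> and \<open>b\<close> stand for the cofactors of the
  Jacobian matrix belonging to the direction \<open>v\<close>.\<close>

lemma has_weak_deriv_transport:
  fixes h hx hy H G a b :: "complex \<Rightarrow> complex"
  assumes h: "has_weak_deriv \<Omega> 1 h hx" "has_weak_deriv \<Omega> \<i> h hy"
    and H: "\<And>z. z \<in> \<Omega> \<Longrightarrow> H (\<Phi> z) = h z"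
    and ab: "smooth a" "smooth b"
    and piola: "\<And>\<phi> z. smooth \<phi> \<Longrightarrow> J z * dir_deriv v \<phi> (\<Phi> z) =
      dir_deriv 1 (\<lambda>z. a z * \<phi> (\<Phi> z)) z + dir_deriv \<i> (\<lambda>z. b z * \<phi> (\<Phi> z)) z"
    and G: "\<And>z. z \<in> \<Omega> \<Longrightarrow> J z * G (\<Phi> z) = a z * hx z + b z * hy z"
  shows "has_weak_deriv \<Omega> v H G"
  unfolding has_weak_deriv_def
proof (intro conjI ballI)
  have l: "locally_integrable \<Omega> h" "locally_integrable \<Omega> hx" "locally_integrable \<Omega> hy"
    using h by (auto simp: has_weak_deriv_def)
  show "locally_integrable \<Omega> H"
    by (rule locally_integrable_transfer[OF locally_integrable_mult_continuous[OF l(1) continuous_J]])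
       (simp add: H)
  have "locally_integrable \<Omega> (\<lambda>z. hx z * a z)" "locally_integrable \<Omega> (\<lambda>z. hy z * b z)"
    using l smooth_continuous[OF ab(1)] smooth_continuous[OF ab(2)]
    by (auto intro: locally_integrable_mult_continuous)
  then have lG: "locally_integrable \<Omega> (\<lambda>z. hx z * a z + hy z * b z)"
    by (simp add: locally_integrable_def)
  then show "locally_integrable \<Omega> G"
    by (rule locally_integrable_transfer) (simp add: G)
  fix \<phi> assume \<phi>: "\<phi> \<in> test_functions \<Omega>"
  define \<psi> where "\<psi> z = \<phi> (\<Phi> z)" for z
  have \<psi>: "\<psi> \<in> test_functions \<Omega>"
    using test_function_compose[OF \<phi>] by (simp add: \<psi>_def[abs_def])
  have mult: "(\<lambda>z. c z * \<psi> z) \<in> test_functions \<Omega>" if "smooth c" for c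
  proof -
    obtain K where K: "compact K" "K \<subseteq> \<Omega>" "\<And>z. z \<notin> K \<Longrightarrow> \<psi> z = 0"
      using test_function_support[OF \<psi>] by blast
    show ?thesis
      by (rule test_functionI[OF smooth_mult[OF that test_function_smooth[OF \<psi>]] K(1,2)]) (simp add: K(3))
  qed
  note a\<psi> = mult[OF ab(1)] and b\<psi> = mult[OF ab(2)]
  have int: "integrable (lebesgue_on \<Omega>) (\<lambda>z. f z * dir_deriv w \<theta> z)"
    if "locally_integrable \<Omega> f" "\<theta> \<in> test_functions \<Omega>" for f w \<theta>
    by (rule distr_of_integrable[OF open_domain that(1) test_function_dir_deriv[OF that(2)]])
  have "(LINT z|lebesgue_on \<Omega>. H z * dir_deriv v \<phi> z) =
      (LINT z|lebesgue_on \<Omega>. J z * (H (\<Phi> z) * dir_deriv v \<phi> (\<Phi> z)))"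
    by (rule change_of_variables_domain(2))
  also have "\<dots> = (LINT z|lebesgue_on \<Omega>. h z * dir_deriv 1 (\<lambda>z. a z * \<psi> z) z + h z * dir_deriv \<i> (\<lambda>z. b z * \<psi> z) z)"
  proof (rule Bochner_Integration.integral_cong[OF refl])
    fix z assume "z \<in> space (lebesgue_on \<Omega>)"
    then have "J z * (H (\<Phi> z) * dir_deriv v \<phi> (\<Phi> z)) = h z * (J z * dir_deriv v \<phi> (\<Phi> z))"
      by (simp add: H)
    then show "J z * (H (\<Phi> z) * dir_deriv v \<phi> (\<Phi> z)) =
        h z * dir_deriv 1 (\<lambda>z. a z * \<psi> z) z + h z * dir_deriv \<i> (\<lambda>z. b z * \<psi> z) z"
      unfolding \<psi>_def piola[OF test_function_smooth[OF \<phi>]] distrib_left .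
  qed
  also have "\<dots> = (LINT z|lebesgue_on \<Omega>. h z * dir_deriv 1 (\<lambda>z. a z * \<psi> z) z) +
      (LINT z|lebesgue_on \<Omega>. h z * dir_deriv \<i> (\<lambda>z. b z * \<psi> z) z)"
    by (intro Bochner_Integration.integral_add int l a\<psi> b\<psi>)
  also have "\<dots> = - (LINT z|lebesgue_on \<Omega>. hx z * (a z * \<psi> z)) - (LINT z|lebesgue_on \<Omega>. hy z * (b z * \<psi> z))"
  proof -
    have eqs: "- (LINT z|lebesgue_on \<Omega>. h z * dir_deriv 1 (\<lambda>z. a z * \<psi> z) z) = (LINT z|lebesgue_on \<Omega>. hx z * (a z * \<psi> z))"
      "- (LINT z|lebesgue_on \<Omega>. h z * dir_deriv \<i> (\<lambda>z. b z * \<psi> z) z) = (LINT z|lebesgue_on \<Omega>. hy z * (b z * \<psi> z))"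
      using h a\<psi> b\<psi> by (auto simp: has_weak_deriv_def distr_deriv_def distr_of_def)
    show ?thesis by (simp flip: eqs)
  qed
  also have "\<dots> = - (LINT z|lebesgue_on \<Omega>. hx z * (a z * \<psi> z) + hy z * (b z * \<psi> z))"
    using distr_of_integrable[OF open_domain l(2) a\<psi>] distr_of_integrable[OF open_domain l(3) b\<psi>]
    by simp
  also have "(LINT z|lebesgue_on \<Omega>. hx z * (a z * \<psi> z) + hy z * (b z * \<psi> z)) =
      (LINT z|lebesgue_on \<Omega>. J z * (G (\<Phi> z) * \<phi> (\<Phi> z)))"
  proof (rule Bochner_Integration.integral_cong[OF refl])
    fix z assume "z \<in> space (lebesgue_on \<Omega>)"
    then have "J z * (G (\<Phi> z) * \<phi> (\<Phi> z)) = (a z * hx z + b z * hy z) * \<phi> (\<Phi> z)"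
      using G[of z] by (simp add: mult.assoc flip: mult.assoc)
    then show "hx z * (a z * \<psi> z) + hy z * (b z * \<psi> z) = J z * (G (\<Phi> z) * \<phi> (\<Phi> z))"
      by (simp add: \<psi>_def algebra_simps)
  qed
  also have "\<dots> = (LINT z|lebesgue_on \<Omega>. G z * \<phi> z)"
    by (rule change_of_variables_domain(2)[symmetric])
  finally show "distr_deriv v (distr_of \<Omega> H) \<phi> = distr_of \<Omega> G \<phi>"
    by (simp add: distr_deriv_def distr_of_def)
qed

text \<open>Both identities rest on the rows of the cofactor matrix of \<open>D\<Phi>\<close> being divergence free.\<close>

lemma piola:
  assumes \<phi>: "smooth \<phi>"
  shows "J z * dir_deriv 1 \<phi> (\<Phi> z) =
      dir_deriv 1 (\<lambda>z. complex_of_real (Im (dir_deriv \<i> \<Phi> z)) * \<phi> (\<Phi> z)) z +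
      dir_deriv \<i> (\<lambda>z. - complex_of_real (Im (dir_deriv 1 \<Phi> z)) * \<phi> (\<Phi> z)) z" (is ?A)
    and "J z * dir_deriv \<i> \<phi> (\<Phi> z) =
      dir_deriv 1 (\<lambda>z. - complex_of_real (Re (dir_deriv \<i> \<Phi> z)) * \<phi> (\<Phi> z)) z +
      dir_deriv \<i> (\<lambda>z. complex_of_real (Re (dir_deriv 1 \<Phi> z)) * \<phi> (\<Phi> z)) z" (is ?B)
proof -
  note s = smooth_compose[OF \<phi> smooth_map] smooth_Re[OF smooth_dir_deriv[OF smooth_map]]
    smooth_Im[OF smooth_dir_deriv[OF smooth_map]]
  have neg: "dir_deriv v (\<lambda>z. - f z) z = - dir_deriv v f z" if "smooth f" for f v
    by (rule dir_deriv_bounded_linear[OF that bounded_linear_minus[OF bounded_linear_ident]])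
  \<comment> \<open>When the derivatives fall on the cofactors, the resulting terms cancel by
    symmetry of the second derivatives of \<Phi>; what remains is the chain rule for \<phi> composed
    with \<Phi>.\<close>
  have mixed: "dir_deriv 1 (dir_deriv \<i> \<Phi>) = dir_deriv \<i> (dir_deriv 1 \<Phi>)"
    by (rule dir_deriv_commute[OF smooth_map])
  note rules = neg dir_deriv_mult dir_deriv_bounded_linear[OF smooth_dir_deriv[OF smooth_map] bounded_linear_of_real_Re]
    dir_deriv_bounded_linear[OF smooth_dir_deriv[OF smooth_map] bounded_linear_of_real_Im]
    dir_deriv_compose[OF \<phi> smooth_map] s smooth_minus smooth_mult
  show ?A ?B
    by (simp_all add: rules mixed J_def jacobian_def algebra_simps)
qed

text \<open>The two formulas are Cramer's rule for the linear system that the chain rule for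
  \<open>h = H o \<Phi>\<close> imposes on the partial derivatives of \<open>H\<close>. Dividing by
  \<open>J\<close> and composing with the set-theoretic inverse of \<Phi> defines the
  functions.\<close>

lemma transported_weak_derivs:
  fixes h hx hy H :: "complex \<Rightarrow> complex"
  assumes h: "has_weak_deriv \<Omega> 1 h hx" "has_weak_deriv \<Omega> \<i> h hy"
    and H: "\<And>z. z \<in> \<Omega> \<Longrightarrow> H (\<Phi> z) = h z"
  obtains Gx Gy :: "complex \<Rightarrow> complex" where "has_weak_deriv \<Omega> 1 H Gx" "has_weak_deriv \<Omega> \<i> H Gy"
    "\<And>z. z \<in> \<Omega> \<Longrightarrow> J z * Gx (\<Phi> z) = Im (dir_deriv \<i> \<Phi> z) * hx z - Im (dir_deriv 1 \<Phi> z) * hy z"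
    "\<And>z. z \<in> \<Omega> \<Longrightarrow> J z * Gy (\<Phi> z) = Re (dir_deriv 1 \<Phi> z) * hy z - Re (dir_deriv \<i> \<Phi> z) * hx z"
proof -
  define inverse_map where "inverse_map = the_inv_into \<Omega> \<Phi>"
  have inv: "inverse_map (\<Phi> z) = z" if "z \<in> \<Omega>" for z
    using bij that by (simp add: inverse_map_def bij_betw_def the_inv_into_f_f)
  have J: "J z \<noteq> 0" for z using jac_pos[of z] by (simp add: J_def)
  define gx where "gx z = (Im (dir_deriv \<i> \<Phi> z) * hx z - Im (dir_deriv 1 \<Phi> z) * hy z) / J z" for z
  define gy where "gy z = (Re (dir_deriv 1 \<Phi> z) * hy z - Re (dir_deriv \<i> \<Phi> z) * hx z) / J z" for z
  have gx: "J z * gx (inverse_map (\<Phi> z)) = Im (dir_deriv \<i> \<Phi> z) * hx z - Im (dir_deriv 1 \<Phi> z) * hy z"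
    if "z \<in> \<Omega>" for z using that J by (simp add: inv gx_def)
  have gy: "J z * gy (inverse_map (\<Phi> z)) = Re (dir_deriv 1 \<Phi> z) * hy z - Re (dir_deriv \<i> \<Phi> z) * hx z"
    if "z \<in> \<Omega>" for z using that J by (simp add: inv gy_def)
  show thesis
  proof (rule that[of "\<lambda>w. gx (inverse_map w)" "\<lambda>w. gy (inverse_map w)"])
    show "has_weak_deriv \<Omega> 1 H (\<lambda>w. gx (inverse_map w))"
      by (rule has_weak_deriv_transport[OF h H _ _ piola(1)])
         (auto intro!: smooth_minus smooth_Im smooth_Re smooth_dir_deriv smooth_map simp: gx)
    show "has_weak_deriv \<Omega> \<i> H (\<lambda>w. gy (inverse_map w))"
      by (rule has_weak_deriv_transport[OF h H _ _ piola(2)])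
         (auto intro!: smooth_minus smooth_Im smooth_Re smooth_dir_deriv smooth_map simp: gy)
  qed (rule gx gy, assumption)+
qed

end

section \<open>The energy of a transported function\<close>

lemma has_weak_deriv_weak_deriv:
  "has_weak_deriv \<Omega> v f g \<Longrightarrow> has_weak_deriv \<Omega> v f (weak_deriv \<Omega> v f)"
  unfolding weak_deriv_def by (rule someI[where P = "has_weak_deriv \<Omega> v f"])

text \<open>The parallelogram law; it replaces the Wirtinger derivatives in the energy by the two
  coordinate derivatives.\<close>

lemma wirtinger_norm_sum:
  "(cmod ((a - \<i> * b) / 2))\<^sup>2 + (cmod ((a + \<i> * b) / 2))\<^sup>2 = ((cmod a)\<^sup>2 + (cmod b)\<^sup>2) / 2"
  unfolding cmod_power2 by (simp add: power2_eq_square field_simps)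

text \<open>By a.e. uniqueness the energy may be computed with the explicit derivatives of
  \<open>H\<close>. Substituting \<Phi> contributes a factor \<open>J\<close>, while each squared
  derivative contributes \<open>1 / J^2\<close> through Cramer's rule, which leaves the single
  \<open>J\<close> in the denominator.\<close>

lemma (in domain_diffeo) dirichlet_energy_transported:
  fixes h hx hy H :: "complex \<Rightarrow> complex"
  assumes h: "has_weak_deriv \<Omega> 1 h hx" "has_weak_deriv \<Omega> \<i> h hy"
    and H: "\<And>z. z \<in> \<Omega> \<Longrightarrow> H (\<Phi> z) = h z"
  shows "dirichlet_energy \<Omega> H =
    (LINT z|lebesgue_on \<Omega>. ((cmod (Im (dir_deriv \<i> \<Phi> z) * hx z - Im (dir_deriv 1 \<Phi> z) * hy z))\<^sup>2 +
        (cmod (Re (dir_deriv 1 \<Phi> z) * hy z - Re (dir_deriv \<i> \<Phi> z) * hx z))\<^sup>2) / (2 * J z))"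
    (is "_ = (LINT z|_. ?e z)")
proof -
  obtain Gx Gy :: "complex \<Rightarrow> complex" where G: "has_weak_deriv \<Omega> 1 H Gx" "has_weak_deriv \<Omega> \<i> H Gy"
    and Gx: "\<And>z. z \<in> \<Omega> \<Longrightarrow> J z * Gx (\<Phi> z) = Im (dir_deriv \<i> \<Phi> z) * hx z - Im (dir_deriv 1 \<Phi> z) * hy z"
    and Gy: "\<And>z. z \<in> \<Omega> \<Longrightarrow> J z * Gy (\<Phi> z) = Re (dir_deriv 1 \<Phi> z) * hy z - Re (dir_deriv \<i> \<Phi> z) * hx z"
    using transported_weak_derivs[OF h, of H] H by (metis (no_types, lifting))
  note D = G[THEN has_weak_deriv_weak_deriv]
  have meas: "g \<in> borel_measurable (lebesgue_on \<Omega>)" if "has_weak_deriv \<Omega> v H g" for v g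
    using that locally_integrable_measurable[OF open_domain] by (auto simp: has_weak_deriv_def)
  note [measurable] = meas[OF G(1)] meas[OF G(2)] meas[OF D(1)] meas[OF D(2)]
  have "dirichlet_energy \<Omega> H =
      (LINT z|lebesgue_on \<Omega>. ((cmod (weak_deriv \<Omega> 1 H z))\<^sup>2 + (cmod (weak_deriv \<Omega> \<i> H z))\<^sup>2) / 2)"
    unfolding dirichlet_energy_def weak_dz_def weak_dbar_def wirtinger_norm_sum ..
  also have "\<dots> = (LINT z|lebesgue_on \<Omega>. ((cmod (Gx z))\<^sup>2 + (cmod (Gy z))\<^sup>2) / 2)"
  proof (rule integral_cong_AE)
    show "AE z in lebesgue_on \<Omega>. ((cmod (weak_deriv \<Omega> 1 H z))\<^sup>2 + (cmod (weak_deriv \<Omega> \<i> H z))\<^sup>2) / 2 =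
        ((cmod (Gx z))\<^sup>2 + (cmod (Gy z))\<^sup>2) / 2"
      using has_weak_deriv_unique[OF open_domain D(1) G(1)] has_weak_deriv_unique[OF open_domain D(2) G(2)]
      by eventually_elim simp
  qed measurable
  \<comment> \<open>The substitution rule is stated for complex integrands, so the real energy
    density is embedded and recovered at the end.\<close>
  finally have "complex_of_real (dirichlet_energy \<Omega> H) =
      (LINT z|lebesgue_on \<Omega>. complex_of_real (((cmod (Gx z))\<^sup>2 + (cmod (Gy z))\<^sup>2) / 2))"
    by (simp only: integral_complex_of_real)
  also have "\<dots> = (LINT z|lebesgue_on \<Omega>. J z * complex_of_real (((cmod (Gx (\<Phi> z)))\<^sup>2 + (cmod (Gy (\<Phi> z)))\<^sup>2) / 2))"
    by (rule change_of_variables_domain(2))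
  also have "\<dots> = (LINT z|lebesgue_on \<Omega>. complex_of_real (?e z))"
  proof (rule Bochner_Integration.integral_cong[OF refl])
    fix z assume z: "z \<in> space (lebesgue_on \<Omega>)"
    have J: "J z > 0" using jac_pos[of z] by (simp add: J_def)
    have sq: "(cmod (J z * w))\<^sup>2 = J z * (J z * (cmod w)\<^sup>2)" for w :: complex
      using J by (simp add: norm_mult power_mult_distrib power2_eq_square)
    have "?e z = ((cmod (J z * Gx (\<Phi> z)))\<^sup>2 + (cmod (J z * Gy (\<Phi> z)))\<^sup>2) / (2 * J z)"
      using z Gx[of z] Gy[of z] by simp
    also have "\<dots> = J z * (((cmod (Gx (\<Phi> z)))\<^sup>2 + (cmod (Gy (\<Phi> z)))\<^sup>2) / 2)"
      unfolding sq using J by (simp add: field_simps)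
    finally show "J z * complex_of_real (((cmod (Gx (\<Phi> z)))\<^sup>2 + (cmod (Gy (\<Phi> z)))\<^sup>2) / 2) = complex_of_real (?e z)"
      by (simp only: of_real_mult)
  qed
  also have "\<dots> = complex_of_real (LINT z|lebesgue_on \<Omega>. ?e z)"
    by (rule integral_complex_of_real)
  finally show ?thesis by (simp only: of_real_eq_iff)
qed

section \<open>Perturbations of the identity\<close>

text \<open>Every perturbation entry is at most 1/8 in modulus, so the determinant is at least
  \<open>(7/8)^2 - (1/8)^2 = 3/4\<close>.\<close>

lemma jacobian_perturbation_bound:
  assumes "cmod \<alpha> \<le> M" "cmod \<beta> \<le> M" "\<bar>\<epsilon>\<bar> * M \<le> 1/8"
  shows "Re (1 + of_real \<epsilon> * \<alpha>) * Im (\<i> + of_real \<epsilon> * \<beta>) - Im (1 + of_real \<epsilon> * \<alpha>) * Re (\<i> + of_real \<epsilon> * \<beta>) \<ge> 1/2"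
proof -
  have small: "\<bar>\<epsilon> * x\<bar> \<le> 1/8" if "\<bar>x\<bar> \<le> M" for x
    using mult_left_mono[OF that, of "\<bar>\<epsilon>\<bar>"] assms(3) by (simp add: abs_mult)
  have b: "\<bar>\<epsilon> * Re \<alpha>\<bar> \<le> 1/8" "\<bar>\<epsilon> * Im \<alpha>\<bar> \<le> 1/8" "\<bar>\<epsilon> * Re \<beta>\<bar> \<le> 1/8" "\<bar>\<epsilon> * Im \<beta>\<bar> \<le> 1/8"
    using assms(1,2) abs_Re_le_cmod abs_Im_le_cmod by (meson small order_trans)+
  have "(7/8) * (7/8) \<le> (1 + \<epsilon> * Re \<alpha>) * (1 + \<epsilon> * Im \<beta>)"
    by (rule mult_mono) (use b in auto)
  moreover have "\<bar>(\<epsilon> * Im \<alpha>) * (\<epsilon> * Re \<beta>)\<bar> \<le> (1/8) * (1/8)"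
    unfolding abs_mult[of "\<epsilon> * Im \<alpha>"] by (rule mult_mono) (use b in auto)
  ultimately show ?thesis by simp
qed

text \<open>The perturbation \<open>\<epsilon> * \<eta>\<close> is a contraction with constant 1/4,
  so \<Phi> is injective, and the Banach fixed point theorem makes it onto the plane. Off the
  support it is the identity, which forces it to preserve \<Omega>.\<close>

lemma domain_diffeo_perturbation:
  assumes \<Omega>: "open \<Omega>" and \<eta>: "\<eta> \<in> test_functions \<Omega>"
    and M: "\<And>z. cmod (dir_deriv 1 \<eta> z) \<le> M" "\<And>z. cmod (dir_deriv \<i> \<eta> z) \<le> M"
    and \<epsilon>: "\<bar>\<epsilon>\<bar> * M \<le> 1/8"
  shows "domain_diffeo \<Omega> (\<lambda>z. z + of_real \<epsilon> * \<eta> z)"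
proof -
  define \<Phi> where "\<Phi> z = z + of_real \<epsilon> * \<eta> z" for z
  note s\<eta> = test_function_smooth[OF \<eta>]
  have smooth: "smooth \<Phi>"
    unfolding \<Phi>_def by (intro smooth_add smooth_ident smooth_mult smooth_const s\<eta>)
  have deriv: "dir_deriv v \<Phi> z = v + of_real \<epsilon> * dir_deriv v \<eta> z" for v z
    unfolding \<Phi>_def
    by (rule dir_deriv_eq) (intro has_derivative_add has_derivative_ident has_derivative_mult_right
        smooth_has_derivative s\<eta>)
  have lip: "cmod (\<eta> x - \<eta> y) \<le> 2 * M * cmod (x - y)" for x y
  proof (rule differentiable_bound[OF convex_UNIV])
    show "(\<eta> has_derivative (\<lambda>v. dir_deriv v \<eta> z)) (at z within UNIV)" for z
      using smooth_has_derivative[OF s\<eta>] by simp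
    \<comment> \<open>The factor 2 comes from bounding both \<open>Re v\<close> and
      \<open>Im v\<close> by \<open>cmod v\<close>.\<close>
    show "onorm (\<lambda>v. dir_deriv v \<eta> z) \<le> 2 * M" for z
    proof (rule onorm_le)
      fix v
      have "cmod (dir_deriv v \<eta> z) \<le> cmod (Re v * dir_deriv 1 \<eta> z) + cmod (Im v * dir_deriv \<i> \<eta> z)"
        unfolding dir_deriv_linear[OF s\<eta>, of v] by (rule norm_triangle_ineq)
      also have "\<dots> \<le> cmod v * M + cmod v * M"
        unfolding norm_mult norm_of_real
        by (intro add_mono mult_mono M abs_Re_le_cmod abs_Im_le_cmod) auto
      finally show "cmod (dir_deriv v \<eta> z) \<le> 2 * M * cmod v" by (simp add: mult_ac)
    qed
  qed auto
  have contr: "cmod (of_real \<epsilon> * \<eta> x - of_real \<epsilon> * \<eta> y) \<le> 1/4 * cmod (x - y)" for x y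
  proof -
    have "cmod (of_real \<epsilon> * \<eta> x - of_real \<epsilon> * \<eta> y) = \<bar>\<epsilon>\<bar> * cmod (\<eta> x - \<eta> y)"
      by (simp add: norm_mult flip: right_diff_distrib)
    also have "\<dots> \<le> \<bar>\<epsilon>\<bar> * (2 * M * cmod (x - y))"
      by (rule mult_left_mono[OF lip]) simp
    also have "\<dots> = 2 * (\<bar>\<epsilon>\<bar> * M) * cmod (x - y)" by simp
    also have "\<dots> \<le> 2 * (1/8) * cmod (x - y)"
      using \<epsilon> by (intro mult_right_mono mult_left_mono) auto
    finally show ?thesis by simp
  qed
  have inj: "x = y" if "\<Phi> x = \<Phi> y" for x y
  proof -
    have "x - y = - (of_real \<epsilon> * \<eta> x - of_real \<epsilon> * \<eta> y)"
      using that by (simp add: \<Phi>_def algebra_simps)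
    then have "cmod (x - y) \<le> 1/4 * cmod (x - y)"
      using contr[of x y] by (metis norm_minus_cancel)
    then show ?thesis by simp
  qed
  have surj: "\<exists>x. \<Phi> x = z" for z
  proof -
    \<comment> \<open>A preimage of \<open>z\<close> under \<Phi> is a fixed point of this
      contraction.\<close>
    have "\<exists>!x. z - of_real \<epsilon> * \<eta> x = x"
    proof (rule banach_fix_type[of "1/4"])
      show "\<forall>x y. dist (z - of_real \<epsilon> * \<eta> x) (z - of_real \<epsilon> * \<eta> y) \<le> 1/4 * dist x y"
        using contr by (simp add: dist_norm norm_minus_commute)
    qed auto
    then show ?thesis by (metis \<Phi>_def add.commute diff_add_cancel)
  qed
  obtain C where C: "compact C" "C \<subseteq> \<Omega>" "\<And>z. z \<notin> C \<Longrightarrow> \<eta> z = 0"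
    using test_function_support[OF \<eta>] by blast
  have fix_C: "\<Phi> z = z" if "z \<notin> C" for z using C(3)[OF that] by (simp add: \<Phi>_def)
  \<comment> \<open>If \<open>\<Phi> z\<close> lay outside \<open>C\<close>, it would be fixed by
    \<Phi>, and injectivity would give \<open>\<Phi> z = z\<close>, a point of
    \<open>C\<close>.\<close>
  have maps_C: "\<Phi> z \<in> C" if "z \<in> C" for z
    using fix_C[of "\<Phi> z"] inj[of "\<Phi> z" z] that by metis
  have mem: "\<Phi> z \<in> \<Omega> \<longleftrightarrow> z \<in> \<Omega>" for z
    using fix_C[of z] maps_C[of z] C(2) by (cases "z \<in> C") auto
  have "domain_diffeo \<Omega> \<Phi>"
  proof
    show "bij_betw \<Phi> \<Omega> \<Omega>"
      unfolding bij_betw_def inj_on_def using inj surj mem by (auto simp: image_iff) metis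
    show "jacobian (\<lambda>v. dir_deriv v \<Phi> z) > 0" for z
      using jacobian_perturbation_bound[OF M(1)[of z] M(2)[of z] \<epsilon>]
      by (simp only: deriv jacobian_def)
    show "compact (\<Phi> -` K) \<and> \<Phi> -` K \<subseteq> \<Omega>" if K: "compact K" "K \<subseteq> \<Omega>" for K
    proof
      show "\<Phi> -` K \<subseteq> \<Omega>" using K(2) mem by auto
      \<comment> \<open>\<Phi> moves points by at most \<open>\<bar>\<epsilon>\<bar> * B\<close>, so
        preimages of bounded sets are bounded.\<close>
      obtain B where B: "\<And>z. cmod (\<eta> z) \<le> B" using test_function_bounded[OF \<eta>] by blast
      obtain R where R: "\<And>z. z \<in> K \<Longrightarrow> cmod z \<le> R" using compact_imp_bounded[OF K(1)] bounded_iff by metis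
      have "cmod z \<le> R + \<bar>\<epsilon>\<bar> * B" if "\<Phi> z \<in> K" for z
      proof -
        have "cmod z = cmod (\<Phi> z - of_real \<epsilon> * \<eta> z)" by (simp add: \<Phi>_def)
        also have "\<dots> \<le> cmod (\<Phi> z) + \<bar>\<epsilon>\<bar> * cmod (\<eta> z)"
          using norm_triangle_ineq4[of "\<Phi> z" "of_real \<epsilon> * \<eta> z"] by (simp add: norm_mult)
        also have "\<dots> \<le> R + \<bar>\<epsilon>\<bar> * B"
          by (intro add_mono R that mult_left_mono B) auto
        finally show ?thesis .
      qed
      then have "bounded (\<Phi> -` K)" by (auto simp: bounded_iff)
      moreover have "closed (\<Phi> -` K)"
        by (rule closed_vimage[OF compact_imp_closed[OF K(1)] smooth_continuous[OF smooth]])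
      ultimately show "compact (\<Phi> -` K)" by (simp add: compact_eq_bounded_closed)
    qed
  qed (use \<Omega> smooth in auto)
  then show ?thesis by (simp add: \<Phi>_def[abs_def])
qed

text \<open>A pointwise Taylor expansion with uniform error. Here \<open>p\<close> and
  \<open>q\<close> are the columns of the Jacobian matrix of the perturbed identity, and
  \<open>u\<close> and \<open>w\<close> the partial derivatives of \<open>h\<close>. With
  \<open>S\<close> the sum of their squared norms, the density is
  \<open>(S + 2 \<epsilon> T + \<epsilon>^2 R) / (2 J)\<close>, where
  \<open>J = 1 + \<epsilon> t + \<epsilon>^2 d\<close>; its first-order coefficient is
  \<open>D = T - t S / 2\<close>, which is the stated real part.\<close>

lemma energy_density_expansion:
  fixes \<alpha> \<beta> u w :: complex and \<epsilon> M :: real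
  assumes \<alpha>: "cmod \<alpha> \<le> M" and \<beta>: "cmod \<beta> \<le> M" and \<epsilon>: "\<bar>\<epsilon>\<bar> * M \<le> 1/8"
  defines "p \<equiv> 1 + of_real \<epsilon> * \<alpha>" and "q \<equiv> \<i> + of_real \<epsilon> * \<beta>"
  shows "\<bar>((cmod (Im q * u - Im p * w))\<^sup>2 + (cmod (Re p * w - Re q * u))\<^sup>2) / (2 * (Re p * Im q - Im p * Re q))
      - ((cmod u)\<^sup>2 + (cmod w)\<^sup>2) / 2
      - \<epsilon> * (- 2 * Re ((u - \<i> * w) / 2 * cnj ((u + \<i> * w) / 2) * (\<alpha> + \<i> * \<beta>)))\<bar>
    \<le> 20 * M\<^sup>2 * \<epsilon>\<^sup>2 * ((cmod u)\<^sup>2 + (cmod w)\<^sup>2)"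
proof -
  define a1 b1 a2 b2 where ab: "a1 = Re \<alpha>" "b1 = Im \<alpha>" "a2 = Re \<beta>" "b2 = Im \<beta>"
  have bnd: "\<bar>a1\<bar> \<le> M" "\<bar>b1\<bar> \<le> M" "\<bar>a2\<bar> \<le> M" "\<bar>b2\<bar> \<le> M"
    using \<alpha> \<beta> abs_Re_le_cmod abs_Im_le_cmod unfolding ab by (meson order_trans)+
  have M: "M \<ge> 0" using norm_ge_zero \<alpha> order_trans by blast
  define P Q c where PQ: "P = (cmod u)\<^sup>2" "Q = (cmod w)\<^sup>2" "c = Re (u * cnj w)"
  define S where "S = P + Q"
  have P0: "P \<ge> 0" "Q \<ge> 0" by (simp_all add: PQ)
  have c: "\<bar>c\<bar> \<le> S / 2"
  proof -
    have "\<bar>c\<bar> \<le> cmod u * cmod w"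
      unfolding PQ by (metis abs_Re_le_cmod complex_mod_cnj norm_mult)
    also have "\<dots> \<le> S / 2"
      using sum_squares_bound[of "cmod u" "cmod w"] by (simp add: S_def PQ)
    finally show ?thesis .
  qed
  define T where "T = b2 * P + a1 * Q - (b1 + a2) * c"
  define R where "R = b2\<^sup>2 * P + b1\<^sup>2 * Q + a1\<^sup>2 * Q + a2\<^sup>2 * P - 2 * (b1 * b2 * c) - 2 * (a1 * a2 * c)"
  define t where "t = a1 + b2"
  define d where "d = a1 * b2 - a2 * b1"
  define J where "J = 1 + \<epsilon> * t + \<epsilon>\<^sup>2 * d"
  define D where "D = T - t * S / 2"
  have J_eq: "Re p * Im q - Im p * Re q = J"
    by (simp add: p_def q_def J_def t_def d_def ab power2_eq_square algebra_simps)
  have J: "J \<ge> 1/2"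
    using jacobian_perturbation_bound[OF \<alpha> \<beta> \<epsilon>] J_eq by (simp add: p_def q_def)
  have N_eq: "(cmod (Im q * u - Im p * w))\<^sup>2 + (cmod (Re p * w - Re q * u))\<^sup>2 = S + 2 * \<epsilon> * T + \<epsilon>\<^sup>2 * R"
    unfolding S_def T_def R_def PQ cmod_power2 ab p_def q_def
    by (simp add: power2_eq_square algebra_simps)
  have D_eq: "- 2 * Re ((u - \<i> * w) / 2 * cnj ((u + \<i> * w) / 2) * (\<alpha> + \<i> * \<beta>)) = D"
    unfolding D_def T_def t_def S_def PQ cmod_power2 ab
    by (simp add: power2_eq_square field_simps)
  \<comment> \<open>Once the numerator is compared with \<open>(S + 2 \<epsilon> D) J\<close>, the
    choice of \<open>D\<close> cancels the linear terms, and \<open>K\<close> collects the rest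
    divided by \<epsilon> squared.\<close>
  define K where "K = R - S * d - t * (2 * D) - \<epsilon> * d * (2 * D)"
  have expand: "S + 2 * \<epsilon> * T + \<epsilon>\<^sup>2 * R - (S + 2 * \<epsilon> * D) * J = \<epsilon>\<^sup>2 * K"
    by (simp add: J_def D_def K_def power2_eq_square field_simps)
  have prod: "\<bar>x * y\<bar> \<le> X * Y" if "\<bar>x\<bar> \<le> X" "\<bar>y\<bar> \<le> Y" for x y X Y :: real
    unfolding abs_mult using that by (intro mult_mono) auto
  have S0: "S \<ge> 0" using P0 by (simp add: S_def)
  have absS: "\<bar>S\<bar> \<le> S" "\<bar>P\<bar> \<le> P" "\<bar>Q\<bar> \<le> Q" using S0 P0 by auto
  have t: "\<bar>t\<bar> \<le> 2 * M" using bnd by (simp add: t_def)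
  have d: "\<bar>d\<bar> \<le> 2 * (M * M)"
    using prod[OF bnd(1,4)] prod[OF bnd(3,2)] by (simp add: d_def)
  have "\<bar>b1 + a2\<bar> \<le> 2 * M" using bnd by simp
  from prod[OF this c] have "\<bar>T\<bar> \<le> M * P + M * Q + 2 * M * (S / 2)"
    using prod[OF bnd(4) absS(2)] prod[OF bnd(1) absS(3)] unfolding T_def by linarith
  then have T: "\<bar>T\<bar> \<le> 2 * (M * S)" by (simp add: S_def field_simps)
  have D: "\<bar>2 * D\<bar> \<le> 6 * (M * S)"
    using T prod[OF t absS(1)] by (simp add: D_def)
  have "\<bar>R\<bar> \<le> M * M * P + M * M * Q + M * M * Q + M * M * P + 2 * (M * M * (S / 2)) + 2 * (M * M * (S / 2))"
    using prod[OF prod[OF bnd(4,4)] absS(2)] prod[OF prod[OF bnd(2,2)] absS(3)]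
      prod[OF prod[OF bnd(1,1)] absS(3)] prod[OF prod[OF bnd(3,3)] absS(2)]
      prod[OF prod[OF bnd(2,4)] c] prod[OF prod[OF bnd(1,3)] c]
    unfolding R_def power2_eq_square by linarith
  then have R: "\<bar>R\<bar> \<le> 4 * (M * M * S)" by (simp add: S_def field_simps)
  \<comment> \<open>The smallness of \<epsilon> absorbs the cubic term: it loses one factor
    \<epsilon> and keeps the size of the quadratic ones.\<close>
  have "\<bar>\<epsilon> * d\<bar> \<le> M / 4"
  proof -
    have "\<bar>\<epsilon> * d\<bar> \<le> \<bar>\<epsilon>\<bar> * (2 * (M * M))" by (rule prod[OF _ d]) simp
    also have "\<dots> = 2 * M * (\<bar>\<epsilon>\<bar> * M)" by simp
    also have "\<dots> \<le> 2 * M * (1/8)" using \<epsilon> M by (intro mult_left_mono) auto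
    finally show ?thesis by simp
  qed
  from prod[OF this D] have "\<bar>K\<bar> \<le> 4 * (M * M * S) + S * (2 * (M * M)) + 2 * M * (6 * (M * S)) + M / 4 * (6 * (M * S))"
    using R prod[OF absS(1) d] prod[OF t D] unfolding K_def by linarith
  \<comment> \<open>The four contributions are 4, 2, 12 and 3/2.\<close>
  also have "\<dots> = (39/2) * (M * M * S)" by (simp add: algebra_simps)
  also have "\<dots> \<le> 20 * (M * M * S)"
    using mult_nonneg_nonneg[OF mult_nonneg_nonneg[OF M M] S0] by simp
  finally have K: "\<bar>K\<bar> \<le> 20 * (M * M * S)" .
  have "(S + 2 * \<epsilon> * T + \<epsilon>\<^sup>2 * R) / (2 * J) - S / 2 - \<epsilon> * D = \<epsilon>\<^sup>2 * K / (2 * J)"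
    using expand J by (simp add: field_simps)
  \<comment> \<open>Since \<open>J\<close> is at least 1/2, the denominator \<open>2 * J\<close> is
    at least 1.\<close>
  also have "\<bar>\<dots>\<bar> \<le> \<epsilon>\<^sup>2 * \<bar>K\<bar> / 1"
    unfolding abs_divide abs_mult using J by (intro frac_le) auto
  also have "\<dots> \<le> \<epsilon>\<^sup>2 * (20 * (M * M * S))" using K by (simp add: mult_left_mono)
  finally show ?thesis
    unfolding N_eq J_eq D_eq PQ(1,2)[symmetric] S_def[symmetric] by (simp add: power2_eq_square mult_ac)
qed

lemma DERIV_quadratic_error:
  fixes f :: "real \<Rightarrow> real"
  assumes "\<delta> > 0" and err: "\<And>x. \<bar>x\<bar> < \<delta> \<Longrightarrow> \<bar>f x - f 0 - x * L\<bar> \<le> C * x\<^sup>2"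
  shows "(f has_real_derivative L) (at 0)"
proof -
  have "((\<lambda>x. (f x - f 0) / x - L) \<longlongrightarrow> 0) (at 0)"
  proof (rule Lim_null_comparison)
    show "\<forall>\<^sub>F x in at 0. norm ((f x - f 0) / x - L) \<le> C * \<bar>x\<bar>"
      unfolding eventually_at
    proof (intro exI conjI ballI impI)
      fix x :: real assume x: "x \<noteq> 0 \<and> dist x 0 < \<delta>"
      then have "norm ((f x - f 0) / x - L) = \<bar>f x - f 0 - x * L\<bar> / \<bar>x\<bar>"
        by (simp add: field_simps flip: abs_divide)
      also have "\<dots> \<le> C * x\<^sup>2 / \<bar>x\<bar>" using err[of x] x by (intro divide_right_mono) auto
      also have "\<dots> = C * \<bar>x\<bar>" using x by (simp add: power2_eq_square abs_if)
      finally show "norm ((f x - f 0) / x - L) \<le> C * \<bar>x\<bar>" .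
    qed fact
    show "((\<lambda>x. C * \<bar>x\<bar>) \<longlongrightarrow> 0) (at 0)" by (auto intro!: tendsto_eq_intros)
  qed
  then show ?thesis using LIM_zero_cancel by (simp add: has_field_derivative_iff)
qed

section \<open>The first variation of the energy\<close>

text \<open>Membership in \<open>W12\<close> provides some square integrable weak derivative; the
  one selected by \<open>weak_deriv\<close> agrees with it almost everywhere and inherits square
  integrability.\<close>

lemma W12_weak_deriv:
  assumes \<Omega>: "open \<Omega>" and h: "h \<in> W12 \<Omega>" and v: "v \<in> {1, \<i>}"
  shows "has_weak_deriv \<Omega> v h (weak_deriv \<Omega> v h)"
    and "weak_deriv \<Omega> v h \<in> borel_measurable (lebesgue_on \<Omega>)"
    and "integrable (lebesgue_on \<Omega>) (\<lambda>z. (cmod (weak_deriv \<Omega> v h z))\<^sup>2)"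
proof -
  obtain g where g: "g \<in> L2 \<Omega>" "has_weak_deriv \<Omega> v h g"
    using h v unfolding W12_def by blast
  show d: "has_weak_deriv \<Omega> v h (weak_deriv \<Omega> v h)"
    by (rule has_weak_deriv_weak_deriv[OF g(2)])
  then show [measurable]: "weak_deriv \<Omega> v h \<in> borel_measurable (lebesgue_on \<Omega>)"
    using locally_integrable_measurable[OF \<Omega>] by (auto simp: has_weak_deriv_def)
  have [measurable]: "g \<in> borel_measurable (lebesgue_on \<Omega>)"
    and "integrable (lebesgue_on \<Omega>) (\<lambda>z. (cmod (g z))\<^sup>2)"
    using g(1) by (auto simp: L2_def)
  moreover have "AE z in lebesgue_on \<Omega>. (cmod (weak_deriv \<Omega> v h z))\<^sup>2 = (cmod (g z))\<^sup>2"
    using has_weak_deriv_unique[OF \<Omega> d g(2)] by eventually_elim simp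
  ultimately show "integrable (lebesgue_on \<Omega>) (\<lambda>z. (cmod (weak_deriv \<Omega> v h z))\<^sup>2)"
    by (subst integrable_cong_AE[where g = "\<lambda>z. (cmod (g z))\<^sup>2"]) auto
qed

text \<open>The pointwise expansion is integrated over \<Omega>. Its error is at most a constant
  times \<epsilon> squared times the integrable function \<open>S\<close>, so
  \<open>DERIV_quadratic_error\<close> identifies the derivative as the integral of the first-order
  coefficient.\<close>

lemma inner_variation_derivative:
  assumes \<Omega>: "open \<Omega>" and h: "h \<in> W12 \<Omega>" and \<eta>: "\<eta> \<in> test_functions \<Omega>"
  shows "((\<lambda>\<epsilon>. dirichlet_energy \<Omega> (inner_variation \<Omega> \<eta> h \<epsilon>)) has_real_derivative
    4 * Re (distr_dbar (distr_of \<Omega> (\<lambda>\<xi>. weak_dz \<Omega> h \<xi> * cnj (weak_dbar \<Omega> h \<xi>))) \<eta>)) (at 0)"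
proof -
  define \<mu> where "\<mu> = lebesgue_on \<Omega>"
  define hx hy where "hx = weak_deriv \<Omega> 1 h" and "hy = weak_deriv \<Omega> \<i> h"
  have wd: "has_weak_deriv \<Omega> 1 h hx" "has_weak_deriv \<Omega> \<i> h hy"
    and [measurable]: "hx \<in> borel_measurable \<mu>" "hy \<in> borel_measurable \<mu>"
    and sq: "integrable \<mu> (\<lambda>z. (cmod (hx z))\<^sup>2)" "integrable \<mu> (\<lambda>z. (cmod (hy z))\<^sup>2)"
    unfolding hx_def hy_def \<mu>_def using W12_weak_deriv[OF \<Omega> h] by simp_all
  define S where "S z = (cmod (hx z))\<^sup>2 + (cmod (hy z))\<^sup>2" for z
  have S: "integrable \<mu> S" unfolding S_def using sq by simp
  define \<alpha> \<beta> where "\<alpha> = dir_deriv 1 \<eta>" and "\<beta> = dir_deriv \<i> \<eta>"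
  note s\<eta> = test_function_smooth[OF \<eta>]
  have test: "\<alpha> \<in> test_functions \<Omega>" "\<beta> \<in> test_functions \<Omega>"
    unfolding \<alpha>_def \<beta>_def by (rule test_function_dir_deriv[OF \<eta>])+
  have "f \<in> borel_measurable \<mu>" if "f \<in> test_functions \<Omega>" for f
    unfolding \<mu>_def using \<Omega> smooth_continuous[OF test_function_smooth[OF that]]
    by (intro continuous_imp_measurable_on_sets_lebesgue) auto
  note [measurable] = this[OF test(1)] this[OF test(2)]
  obtain M1 where M1: "M1 > 0" "\<And>z. cmod (\<alpha> z) \<le> M1" using test_function_bounded[OF test(1)] by blast
  obtain M2 where M2: "\<And>z. cmod (\<beta> z) \<le> M2" using test_function_bounded[OF test(2)] by blast
  define M where "M = max M1 M2"
  have M: "M > 0" "\<And>z. cmod (\<alpha> z) \<le> M" "\<And>z. cmod (\<beta> z) \<le> M"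
    using M1 M2 by (auto simp: M_def max.coboundedI1 max.coboundedI2)
  \<comment> \<open>The transported energy density of \<open>dirichlet_energy_transported\<close>,
    with the derivatives of the perturbed identity inserted.\<close>
  define e where "e \<epsilon> z =
    ((cmod (Im (\<i> + of_real \<epsilon> * \<beta> z) * hx z - Im (1 + of_real \<epsilon> * \<alpha> z) * hy z))\<^sup>2 +
     (cmod (Re (1 + of_real \<epsilon> * \<alpha> z) * hy z - Re (\<i> + of_real \<epsilon> * \<beta> z) * hx z))\<^sup>2) /
    (2 * (Re (1 + of_real \<epsilon> * \<alpha> z) * Im (\<i> + of_real \<epsilon> * \<beta> z) - Im (1 + of_real \<epsilon> * \<alpha> z) * Re (\<i> + of_real \<epsilon> * \<beta> z)))"
    for \<epsilon> :: real and z
  have energy: "dirichlet_energy \<Omega> (inner_variation \<Omega> \<eta> h \<epsilon>) = (LINT z|\<mu>. e \<epsilon> z)"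
    if \<epsilon>: "\<bar>\<epsilon>\<bar> * M \<le> 1/8" for \<epsilon>
  proof -
    interpret domain_diffeo \<Omega> "\<lambda>z. z + of_real \<epsilon> * \<eta> z"
      using domain_diffeo_perturbation[OF \<Omega> \<eta> _ _ \<epsilon>] M(2,3) unfolding \<alpha>_def \<beta>_def by blast
    have deriv: "dir_deriv v (\<lambda>z. z + of_real \<epsilon> * \<eta> z) z = v + of_real \<epsilon> * dir_deriv v \<eta> z" for v z
      by (rule dir_deriv_eq) (intro has_derivative_add has_derivative_ident has_derivative_mult_right
          smooth_has_derivative s\<eta>)
    have "inner_variation \<Omega> \<eta> h \<epsilon> (z + of_real \<epsilon> * \<eta> z) = h z" if "z \<in> \<Omega>" for z
      unfolding inner_variation_def
      using the_inv_into_f_f[OF bij_betw_imp_inj_on[OF bij] that] by simp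
    from dirichlet_energy_transported[OF wd this] show ?thesis
      unfolding e_def \<mu>_def J_def jacobian_def deriv \<alpha>_def \<beta>_def .
  qed
  \<comment> \<open>This is the product \<open>weak_dz * cnj weak_dbar\<close> of the Hopf-Laplace
    equation, written in coordinate derivatives; it is dominated by \<open>S\<close>, hence
    integrable.\<close>
  define q where "q z = (hx z - \<i> * hy z) / 2 * cnj ((hx z + \<i> * hy z) / 2)" for z
  define D where "D z = - 2 * Re (q z * (\<alpha> z + \<i> * \<beta> z))" for z
  have [measurable]: "cnj \<in> borel_measurable borel"
    by (intro borel_measurable_continuous_onI continuous_intros)
  have [measurable]: "q \<in> borel_measurable \<mu>" unfolding q_def by measurable
  have q: "integrable \<mu> q"
  proof (rule Bochner_Integration.integrable_bound[OF S])
    have "cmod (q z) \<le> norm (S z)" for z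
    proof -
      have "2 * cmod (q z) \<le> (cmod ((hx z - \<i> * hy z) / 2))\<^sup>2 + (cmod ((hx z + \<i> * hy z) / 2))\<^sup>2"
        unfolding q_def norm_mult complex_mod_cnj
        using sum_squares_bound[of "cmod ((hx z - \<i> * hy z) / 2)" "cmod ((hx z + \<i> * hy z) / 2)"]
        by simp
      then have "4 * cmod (q z) \<le> S z" unfolding wirtinger_norm_sum by (simp add: S_def)
      then show ?thesis using norm_ge_zero[of "q z"] unfolding real_norm_def by linarith
    qed
    then show "AE z in \<mu>. cmod (q z) \<le> norm (S z)" by simp
  qed simp
  have int_q: "integrable \<mu> (\<lambda>z. q z * f z)"
    if [measurable]: "f \<in> borel_measurable \<mu>" and f: "\<And>z. cmod (f z) \<le> M" for f
  proof (rule Bochner_Integration.integrable_bound)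
    show "integrable \<mu> (\<lambda>z. M * norm (q z))" using q by simp
    show "AE z in \<mu>. norm (q z * f z) \<le> norm (M * norm (q z))"
      using f M(1) by (intro AE_I2) (simp add: norm_mult abs_mult mult.commute mult_right_mono)
  qed simp
  have q\<alpha>: "integrable \<mu> (\<lambda>z. q z * \<alpha> z)" and q\<beta>: "integrable \<mu> (\<lambda>z. q z * \<beta> z)"
    using int_q M(2,3) by simp_all
  have q\<alpha>\<beta>: "integrable \<mu> (\<lambda>z. q z * (\<alpha> z + \<i> * \<beta> z))"
    using Bochner_Integration.integrable_add[OF q\<alpha> integrable_mult_right[OF q\<beta>, of \<i>]]
    by (simp add: algebra_simps)
  have D: "integrable \<mu> D" unfolding D_def by (intro integrable_mult_right integrable_Re q\<alpha>\<beta>)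
  define T where "T = distr_of \<Omega> (\<lambda>\<xi>. weak_dz \<Omega> h \<xi> * cnj (weak_dbar \<Omega> h \<xi>))"
  \<comment> \<open>Moving the derivative to \<eta> gives the sign, and the Wirtinger derivative the
    factor 1/2; so 4 times the real part of the distribution is the integral of \<open>D\<close>,
    whose coefficient is -2.\<close>
  have "distr_dbar T \<eta> = - ((LINT z|\<mu>. q z * \<alpha> z) + \<i> * (LINT z|\<mu>. q z * \<beta> z)) / 2"
    by (simp add: distr_dbar_def distr_deriv_def T_def distr_of_def weak_dz_def weak_dbar_def q_def
        hx_def hy_def \<alpha>_def \<beta>_def \<mu>_def)
  also have "(LINT z|\<mu>. q z * \<alpha> z) + \<i> * (LINT z|\<mu>. q z * \<beta> z) =
      (LINT z|\<mu>. q z * \<alpha> z + \<i> * (q z * \<beta> z))"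
    using Bochner_Integration.integral_add[OF q\<alpha> integrable_mult_right[OF q\<beta>, of \<i>]]
    by (simp only: integral_mult_right_zero)
  also have "\<dots> = (LINT z|\<mu>. q z * (\<alpha> z + \<i> * \<beta> z))"
    by (simp only: distrib_left mult.left_commute)
  finally have "4 * Re (distr_dbar T \<eta>) = - 2 * Re (LINT z|\<mu>. q z * (\<alpha> z + \<i> * \<beta> z))" by simp
  also have "\<dots> = (LINT z|\<mu>. D z)"
    unfolding D_def integral_mult_right_zero integral_Re[OF q\<alpha>\<beta>] ..
  finally have L: "4 * Re (distr_dbar T \<eta>) = (LINT z|\<mu>. D z)" .
  have bound: "\<bar>e \<epsilon> z - S z / 2 - \<epsilon> * D z\<bar> \<le> 20 * M\<^sup>2 * \<epsilon>\<^sup>2 * S z" if "\<bar>\<epsilon>\<bar> * M \<le> 1/8" for \<epsilon> z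
    using energy_density_expansion[OF M(2)[of z] M(3)[of z] that, of "hx z" "hy z"]
    unfolding e_def S_def D_def q_def .
  have [measurable]: "S \<in> borel_measurable \<mu>" "D \<in> borel_measurable \<mu>" "e \<epsilon> \<in> borel_measurable \<mu>" for \<epsilon>
    unfolding S_def D_def e_def by measurable
  have remainder: "integrable \<mu> (\<lambda>z. e \<epsilon> z - S z / 2 - \<epsilon> * D z)" if "\<bar>\<epsilon>\<bar> * M \<le> 1/8" for \<epsilon>
  proof (rule Bochner_Integration.integrable_bound)
    show "integrable \<mu> (\<lambda>z. 20 * M\<^sup>2 * \<epsilon>\<^sup>2 * S z)" using S by simp
    show "AE z in \<mu>. norm (e \<epsilon> z - S z / 2 - \<epsilon> * D z) \<le> norm (20 * M\<^sup>2 * \<epsilon>\<^sup>2 * S z)"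
      using bound[OF that] by (intro AE_I2) (simp add: S_def)
  qed simp
  define E where "E \<epsilon> = dirichlet_energy \<Omega> (inner_variation \<Omega> \<eta> h \<epsilon>)" for \<epsilon>
  \<comment> \<open>Splitting off \<open>S / 2\<close> and \<open>\<epsilon> * D\<close> leaves a
    remainder already known to be integrable, which justifies integrating term by term.\<close>
  have E: "E \<epsilon> = (LINT z|\<mu>. e \<epsilon> z - S z / 2 - \<epsilon> * D z) + (LINT z|\<mu>. S z) / 2 + \<epsilon> * (LINT z|\<mu>. D z)"
    if "\<bar>\<epsilon>\<bar> * M \<le> 1/8" for \<epsilon>
  proof -
    have "(LINT z|\<mu>. (e \<epsilon> z - S z / 2 - \<epsilon> * D z) + (S z / 2 + \<epsilon> * D z)) =
        (LINT z|\<mu>. e \<epsilon> z - S z / 2 - \<epsilon> * D z) + (LINT z|\<mu>. S z / 2 + \<epsilon> * D z)"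
      using S D by (intro Bochner_Integration.integral_add remainder[OF that]) simp
    also have "(LINT z|\<mu>. S z / 2 + \<epsilon> * D z) = (LINT z|\<mu>. S z) / 2 + \<epsilon> * (LINT z|\<mu>. D z)"
      using S D by simp
    finally show ?thesis using energy[OF that] by (simp add: E_def)
  qed
  have E0: "E 0 = (LINT z|\<mu>. S z) / 2"
    using E[of 0] by (simp add: e_def S_def add.commute)
  have "(E has_real_derivative (LINT z|\<mu>. D z)) (at 0)"
  proof (rule DERIV_quadratic_error)
    show "1 / (8 * M) > 0" using M by simp
    fix \<epsilon> :: real assume "\<bar>\<epsilon>\<bar> < 1 / (8 * M)"
    then have \<epsilon>: "\<bar>\<epsilon>\<bar> * M \<le> 1/8" using M(1) by (simp add: field_simps)
    have "\<bar>E \<epsilon> - E 0 - \<epsilon> * (LINT z|\<mu>. D z)\<bar> = norm (LINT z|\<mu>. e \<epsilon> z - S z / 2 - \<epsilon> * D z)"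
      using E[OF \<epsilon>] E0 by simp
    also have "\<dots> \<le> (LINT z|\<mu>. 20 * M\<^sup>2 * \<epsilon>\<^sup>2 * S z)"
    proof (rule order_trans[OF integral_norm_bound integral_mono])
      show "integrable \<mu> (\<lambda>z. norm (e \<epsilon> z - S z / 2 - \<epsilon> * D z))"
        by (rule integrable_norm[OF remainder[OF \<epsilon>]])
    qed (use bound[OF \<epsilon>] S in auto)
    also have "\<dots> = 20 * M\<^sup>2 * (LINT z|\<mu>. S z) * \<epsilon>\<^sup>2" by simp
    finally show "\<bar>E \<epsilon> - E 0 - \<epsilon> * (LINT z|\<mu>. D z)\<bar> \<le> 20 * M\<^sup>2 * (LINT z|\<mu>. S z) * \<epsilon>\<^sup>2" .
  qed
  then show ?thesis unfolding E_def[abs_def] L[symmetric] T_def .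
qed

lemma test_function_cmult:
  assumes "\<eta> \<in> test_functions \<Omega>"
  shows "(\<lambda>z. c * \<eta> z) \<in> test_functions \<Omega>"
proof -
  obtain K where K: "compact K" "K \<subseteq> \<Omega>" "\<And>z. z \<notin> K \<Longrightarrow> \<eta> z = 0"
    using test_function_support[OF assms] by blast
  show ?thesis
    by (rule test_functionI[OF smooth_mult[OF smooth_const test_function_smooth[OF assms]] K(1,2)])
       (simp add: K(3))
qed

text \<open>The pairing is complex bilinear, so the distribution is complex linear in the test
  function, although the derivative of the energy sees only its real part.\<close>

lemma distr_dbar_cmult:
  assumes "smooth \<eta>"
  shows "distr_dbar (distr_of \<Omega> f) (\<lambda>z. c * \<eta> z) = c * distr_dbar (distr_of \<Omega> f) \<eta>"
proof -
  have "dir_deriv v (\<lambda>z. c * \<eta> z) = (\<lambda>z. c * dir_deriv v \<eta> z)" for v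
    using dir_deriv_bounded_linear[OF assms bounded_linear_mult_right] by blast
  then have "distr_deriv v (distr_of \<Omega> f) (\<lambda>z. c * \<eta> z) = c * distr_deriv v (distr_of \<Omega> f) \<eta>" for v
    by (simp add: distr_deriv_def distr_of_def mult.left_commute[of _ c])
  then show ?thesis by (simp add: distr_dbar_def algebra_simps)
qed

theorem proposition1p8:
  fixes \<Omega> :: "complex set" and h :: "complex \<Rightarrow> complex"
  assumes "open \<Omega>" and "connected \<Omega>" and "\<Omega> \<noteq> {}"
    and "h \<in> W12 \<Omega>"
  shows "(\<forall>\<eta>\<in>test_functions \<Omega>.
            ((\<lambda>\<epsilon>. dirichlet_energy \<Omega> (inner_variation \<Omega> \<eta> h \<epsilon>)) has_real_derivative 0) (at 0))
     \<longleftrightarrow>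
         (\<forall>\<phi>\<in>test_functions \<Omega>.
            distr_dbar (distr_of \<Omega> (\<lambda>\<xi>. weak_dz \<Omega> h \<xi> * cnj (weak_dbar \<Omega> h \<xi>))) \<phi> = 0)"
    (is "?stationary \<longleftrightarrow> (\<forall>\<phi>\<in>_. ?T \<phi> = 0)")
proof
  note deriv = inner_variation_derivative[OF assms(1,4)]
  show ?stationary if "\<forall>\<phi>\<in>test_functions \<Omega>. ?T \<phi> = 0"
    using deriv that by fastforce
  assume stationary: ?stationary
  have Re: "Re (?T \<eta>) = 0" if "\<eta> \<in> test_functions \<Omega>" for \<eta>
    using DERIV_unique[OF deriv[OF that]] stationary that by fastforce
  show "\<forall>\<phi>\<in>test_functions \<Omega>. ?T \<phi> = 0"
  proof
    fix \<phi> assume \<phi>: "\<phi> \<in> test_functions \<Omega>"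
    \<comment> \<open>The real part of \<open>\<i> * ?T \<phi>\<close> is minus the imaginary part
      of \<open>?T \<phi>\<close>.\<close>
    have "Re (\<i> * ?T \<phi>) = 0"
      using Re[OF test_function_cmult[OF \<phi>, of \<i>]] distr_dbar_cmult[OF test_function_smooth[OF \<phi>]] by simp
    then show "?T \<phi> = 0" using Re[OF \<phi>] by (simp add: complex_eq_iff)
  qed
qed

end
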